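(* Let $F$ be a closed, connected, oriented surface, let $\phi: F \to F$ be a periodic, orientation preserving homeomorphism, and let $k$ be an integer relatively prime to the order of $\phi$. Then $\pi_1(M_\phi)$ and $\pi_1(M_{\phi^k})$ have the same finite quotients (i.e. the same set of isomorphism classes of finite quotient groups); hence they have isomorphic profinite completions.
   Context: A homeomorphism $\phi: F\to F$ is periodic if $\phi^n = \mathrm{id}_F$ for some $n \ge 1$; its order is the least such $n$. For a homeomorphism $\phi: F \to F$, $M_\phi$ denotes the mapping torus (surface bundle over $S^1$ with fiber $F$ and monodromy $\phi$) $M_\phi = (F\times[0,1])/\big((\phi(x),0) = (x,1)\big)$. *)

theory Defs
  imports "HOL-Analysis.Analysis" "HOL-Homology.Homology" "HOL-Algebra.Product_Groups"
begin

section \<open>Closed oriented surfaces\<close>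

definition surface :: "'a topology \<Rightarrow> bool" where
  "surface X \<longleftrightarrow> Hausdorff_space X \<and> second_countable X \<and>
     (\<forall>x \<in> topspace X. \<exists>U V. openin X U \<and> x \<in> U \<and> open (V :: (real^2) set) \<and>
        subtopology X U homeomorphic_space top_of_set V)"

text \<open>Surfaces have no boundary by definition, so ``closed'' amounts to compactness.\<close>

definition closed_surface :: "'a topology \<Rightarrow> bool" where
  "closed_surface X \<longleftrightarrow> surface X \<and> compact_space X"

text \<open>An orientation is a choice of generators of the local homology groups
  \<open>H\<^sub>2(X, X - {x})\<close> that is locally constant: near every point, all chosen
  generators are images of one class of \<open>H\<^sub>2(X, X - U)\<close>.\<close>

definition surface_orientation :: "'a topology \<Rightarrow> ('a \<Rightarrow> 'a chain set) \<Rightarrow> bool" where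
  "surface_orientation X \<mu> \<longleftrightarrow>
     (\<forall>x \<in> topspace X.
        \<mu> x \<in> carrier (relative_homology_group 2 X (topspace X - {x})) \<and>
        generate (relative_homology_group 2 X (topspace X - {x})) {\<mu> x}
          = carrier (relative_homology_group 2 X (topspace X - {x}))) \<and>
     (\<forall>x \<in> topspace X. \<exists>U c. openin X U \<and> x \<in> U \<and>
        c \<in> carrier (relative_homology_group 2 X (topspace X - U)) \<and>
        (\<forall>y \<in> U. hom_induced 2 X (topspace X - U) X (topspace X - {y}) id c = \<mu> y))"

definition orientation_preserving ::
    "'a topology \<Rightarrow> ('a \<Rightarrow> 'a chain set) \<Rightarrow> ('a \<Rightarrow> 'a) \<Rightarrow> bool" where
  "orientation_preserving X \<mu> f \<longleftrightarrow>
     (\<forall>x \<in> topspace X.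
        hom_induced 2 X (topspace X - {x}) X (topspace X - {f x}) f (\<mu> x) = \<mu> (f x))"

section \<open>Periodic homeomorphisms and their powers\<close>

definition periodic_map :: "'a topology \<Rightarrow> ('a \<Rightarrow> 'a) \<Rightarrow> bool" where
  "periodic_map X f \<longleftrightarrow> (\<exists>n\<ge>1. \<forall>x \<in> topspace X. (f ^^ n) x = x)"

definition map_order :: "'a topology \<Rightarrow> ('a \<Rightarrow> 'a) \<Rightarrow> nat" where
  "map_order X f = (LEAST n. n \<ge> 1 \<and> (\<forall>x \<in> topspace X. (f ^^ n) x = x))"

definition map_int_power :: "'a topology \<Rightarrow> ('a \<Rightarrow> 'a) \<Rightarrow> int \<Rightarrow> 'a \<Rightarrow> 'a" where
  "map_int_power X f k =
     (if 0 \<le> k then f ^^ nat k else inv_into (topspace X) f ^^ nat (- k))"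

section \<open>Quotient spaces and mapping tori\<close>

definition quotient_topology :: "'a topology \<Rightarrow> ('a \<times> 'a) set \<Rightarrow> 'a set topology" where
  "quotient_topology X r = topology (\<lambda>U. U \<subseteq> topspace X // r \<and>
     openin X {x \<in> topspace X. r `` {x} \<in> U})"

lemma openin_quotient_topology:
  "openin (quotient_topology X r) U \<longleftrightarrow>
     U \<subseteq> topspace X // r \<and> openin X {x \<in> topspace X. r `` {x} \<in> U}"
proof -
  have "istopology (\<lambda>U. U \<subseteq> topspace X // r \<and> openin X {x \<in> topspace X. r `` {x} \<in> U})"
    unfolding istopology_def
  proof (intro conjI allI impI)
    fix S T
    assume S: "S \<subseteq> topspace X // r \<and> openin X {x \<in> topspace X. r `` {x} \<in> S}"
      and T: "T \<subseteq> topspace X // r \<and> openin X {x \<in> topspace X. r `` {x} \<in> T}"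
    show "S \<inter> T \<subseteq> topspace X // r" using S by blast
    have "{x \<in> topspace X. r `` {x} \<in> S \<inter> T} =
        {x \<in> topspace X. r `` {x} \<in> S} \<inter> {x \<in> topspace X. r `` {x} \<in> T}"
      by blast
    then show "openin X {x \<in> topspace X. r `` {x} \<in> S \<inter> T}"
      using openin_Int[OF conjunct2[OF S] conjunct2[OF T]] by simp
  next
    fix K
    assume K: "\<forall>S\<in>K. S \<subseteq> topspace X // r \<and> openin X {x \<in> topspace X. r `` {x} \<in> S}"
    show "\<Union>K \<subseteq> topspace X // r" using K by blast
    have "{x \<in> topspace X. r `` {x} \<in> \<Union>K} = (\<Union>S\<in>K. {x \<in> topspace X. r `` {x} \<in> S})"
      by blast
    then show "openin X {x \<in> topspace X. r `` {x} \<in> \<Union>K}"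
      using K by (auto intro!: openin_Union)
  qed
  then show ?thesis
    unfolding quotient_topology_def by (subst topology_inverse') simp_all
qed

lemma topspace_quotient_topology: "topspace (quotient_topology X r) = topspace X // r"
proof
  show "topspace (quotient_topology X r) \<subseteq> topspace X // r"
    using openin_topspace[of "quotient_topology X r"]
    unfolding openin_quotient_topology by blast
  have "{x \<in> topspace X. r `` {x} \<in> topspace X // r} = topspace X"
    by (auto intro: quotientI)
  then have "openin (quotient_topology X r) (topspace X // r)"
    by (simp add: openin_quotient_topology)
  then show "topspace X // r \<subseteq> topspace (quotient_topology X r)"
    by (rule openin_subset)
qed

definition mapping_torus_rel ::
    "'a topology \<Rightarrow> ('a \<Rightarrow> 'a) \<Rightarrow> (('a \<times> real) \<times> ('a \<times> real)) set" where
  "mapping_torus_rel X f =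
     {(p, q). p \<in> topspace X \<times> {0..1} \<and> q \<in> topspace X \<times> {0..1} \<and>
        equivclp (\<lambda>u v. \<exists>x \<in> topspace X. u = (f x, 0) \<and> v = (x, 1)) p q}"

definition mapping_torus :: "'a topology \<Rightarrow> ('a \<Rightarrow> 'a) \<Rightarrow> ('a \<times> real) set topology" where
  "mapping_torus X f =
     quotient_topology (prod_topology X (top_of_set {0..1})) (mapping_torus_rel X f)"

section \<open>The fundamental group\<close>

definition loops :: "'a topology \<Rightarrow> 'a \<Rightarrow> (real \<Rightarrow> 'a) set" where
  "loops X x = {p. pathin X p \<and> p 0 = x \<and> p 1 = x}"

definition loop_homotopy_rel ::
    "'a topology \<Rightarrow> 'a \<Rightarrow> ((real \<Rightarrow> 'a) \<times> (real \<Rightarrow> 'a)) set" where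
  "loop_homotopy_rel X x =
     {(p, q). p \<in> loops X x \<and> q \<in> loops X x \<and>
        homotopic_with (\<lambda>r. r 0 = x \<and> r 1 = x) (top_of_set {0..1}) X p q}"

text \<open>This is \<^const>\<open>joinpaths\<close> without the sort constraint on the codomain, which the
  points of a mapping torus do not satisfy.\<close>

definition path_concat :: "(real \<Rightarrow> 'a) \<Rightarrow> (real \<Rightarrow> 'a) \<Rightarrow> real \<Rightarrow> 'a" where
  "path_concat p q = (\<lambda>t. if t \<le> 1/2 then p (2 * t) else q (2 * t - 1))"

definition fundamental_group :: "'a topology \<Rightarrow> 'a \<Rightarrow> (real \<Rightarrow> 'a) set monoid" where
  "fundamental_group X x =
     \<lparr>carrier = loops X x // loop_homotopy_rel X x,
      mult = (\<lambda>A B. \<Union>p\<in>A. \<Union>q\<in>B. loop_homotopy_rel X x `` {path_concat p q}),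
      one = loop_homotopy_rel X x `` {\<lambda>_. x}\<rparr>"

section \<open>Finite quotients and profinite completions\<close>

definition finite_index_normal :: "('a, 'b) monoid_scheme \<Rightarrow> 'a set set" where
  "finite_index_normal G = {N. N \<lhd> G \<and> finite (carrier (G Mod N))}"

definition same_finite_quotients ::
    "('a, 'c) monoid_scheme \<Rightarrow> ('b, 'd) monoid_scheme \<Rightarrow> bool" where
  "same_finite_quotients G H \<longleftrightarrow>
     (\<forall>N \<in> finite_index_normal G. \<exists>M \<in> finite_index_normal H. G Mod N \<cong> H Mod M) \<and>
     (\<forall>M \<in> finite_index_normal H. \<exists>N \<in> finite_index_normal G. H Mod M \<cong> G Mod N)"

text \<open>The inverse limit of the finite quotients of \<open>G\<close>; for \<open>N \<subseteq> M\<close> the transition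
  homomorphism \<open>G Mod N \<rightarrow> G Mod M\<close> sends a coset \<open>C\<close> of \<open>N\<close> to the coset \<open>M C\<close> of \<open>M\<close>.\<close>

definition profinite_completion ::
    "('a, 'b) monoid_scheme \<Rightarrow> ('a set \<Rightarrow> 'a set) monoid" where
  "profinite_completion G =
     (product_group (finite_index_normal G) (\<lambda>N. G Mod N))
       \<lparr>carrier := {s \<in> \<Pi>\<^sub>E N \<in> finite_index_normal G. carrier (G Mod N).
          \<forall>N \<in> finite_index_normal G. \<forall>M \<in> finite_index_normal G.
            N \<subseteq> M \<longrightarrow> M <#>\<^bsub>G\<^esub> s N = s M}\<rparr>"

definition profinite_topology :: "('a, 'b) monoid_scheme \<Rightarrow> ('a set \<Rightarrow> 'a set) topology" where
  "profinite_topology G =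
     subtopology
       (product_topology (\<lambda>N. discrete_topology (carrier (G Mod N))) (finite_index_normal G))
       (carrier (profinite_completion G))"

text \<open>Profinite completions are compared as topological groups.\<close>

definition isomorphic_profinite_completions ::
    "('a, 'c) monoid_scheme \<Rightarrow> ('b, 'd) monoid_scheme \<Rightarrow> bool" where
  "isomorphic_profinite_completions G H \<longleftrightarrow>
     (\<exists>h \<in> iso (profinite_completion G) (profinite_completion H).
        homeomorphic_map (profinite_topology G) (profinite_topology H) h)"

end

theory Submission
  imports Defs
begin

text \<open>
  Let \<open>f\<close> be a homeomorphism of \<open>F\<close>. Its mapping torus is the quotient of \<open>F \<times> \<real>\<close> by the group of
  translations \<open>(x, s) \<mapsto> (f\<^sup>-\<^sup>d x, s + d)\<close>, so paths and homotopies in the mapping torus lift to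
  \<open>F \<times> \<real>\<close>. The height of a lifted loop can be straightened; what remains is an integer \<open>d\<close>, the number
  of turns, and a path \<open>\<alpha>\<close> in \<open>F\<close> from the base point \<open>x\<close> to \<open>f\<^sup>-\<^sup>d x\<close>. Hence the fundamental group is the
  set of pairs \<open>(d, [\<alpha>])\<close> with \<open>(d, \<alpha>) (e, \<beta>) = (d + e, \<alpha> \<cdot> f\<^sup>-\<^sup>d \<beta>)\<close>
  (\<open>fundamental_group_torus\<close>).

  Let now \<open>f = \<phi>\<close> have order \<open>n\<close> and let \<open>a k \<equiv> 1\<close> modulo \<open>n\<close>. As \<open>(\<phi>\<^sup>k)\<^sup>-\<^sup>a\<^sup>d = \<phi>\<^sup>-\<^sup>d\<close>, the same path \<open>\<alpha>\<close> that goes with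
  \<open>d\<close> turns in the mapping torus of \<open>\<phi>\<close> goes with \<open>a d\<close> turns in the mapping torus of \<open>\<phi>\<^sup>k\<close>, and
  \<open>(d, \<alpha>) \<mapsto> (a d, \<alpha>)\<close> is a homomorphism from one fundamental group to the other. In the same way
  \<open>(d, \<alpha>) \<mapsto> (b d, \<alpha>)\<close> is a homomorphism back whenever \<open>b \<equiv> k\<close> modulo \<open>n\<close>. The composite sends \<open>g = (d, \<alpha>)\<close> to
  \<open>(a b d, \<alpha>) = g z\<^sup>c\<close>, where \<open>z = (n, const)\<close> and \<open>c = (a b - 1) d / n\<close>. In general no integers satisfy \<open>a b = 1\<close>
  here, but for every \<open>m\<close> there are \<open>a\<close> and \<open>b\<close> with \<open>a b \<equiv> 1\<close> modulo \<open>n m\<close>, and then the composite is the identity up to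
  \<open>m\<close>-th powers. Quotients of order \<open>m\<close> do not see \<open>m\<close>-th powers, so every finite quotient of one
  group is a quotient of the other.

  To get one isomorphism of the profinite completions, the multipliers are chosen as sequences \<open>a\<^sub>i\<close> and
  \<open>b\<^sub>i\<close> that converge to mutually inverse units of the profinite integers
  (\<open>profinite_unit_approximation\<close>). The two resulting sequences of homomorphisms stabilise modulo
  every normal subgroup of finite index, and their limits are mutually inverse continuous maps between
  the completions (\<open>profinitely_equivalent\<close>).
\<close>

section \<open>Paths up to homotopy\<close>

text \<open>Endpoints are arbitrary here, so that loops can be cut into paths; on loops this is the relation
  that defines the fundamental group.\<close>

definition path_homotopic :: "'a topology \<Rightarrow> (real \<Rightarrow> 'a) \<Rightarrow> (real \<Rightarrow> 'a) \<Rightarrow> bool" where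
  "path_homotopic X p q \<longleftrightarrow>
     homotopic_with (\<lambda>r. r 0 = p 0 \<and> r 1 = p 1) (top_of_set {0..1}) X p q"

lemma path_homotopic_iff:
  "path_homotopic X p q \<longleftrightarrow>
     (\<exists>h. continuous_map (prod_topology (top_of_set {0..1}) (top_of_set {0..1})) X h \<and>
        (\<forall>t \<in> {0..1}. h (0, t) = p t \<and> h (1, t) = q t \<and> h (t, 0) = p 0 \<and> h (t, 1) = p 1))"
  unfolding path_homotopic_def by (subst homotopic_with) auto

lemma path_homotopicI:
  fixes h :: "real \<times> real \<Rightarrow> 'a"
  assumes "continuous_map (prod_topology (top_of_set {0..1}) (top_of_set {0..1})) X h"
    and "\<And>t. t \<in> {0..1} \<Longrightarrow> h (0, t) = p t" "\<And>t. t \<in> {0..1} \<Longrightarrow> h (1, t) = q t"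
    and "\<And>u. u \<in> {0..1} \<Longrightarrow> h (u, 0) = p 0" "\<And>u. u \<in> {0..1} \<Longrightarrow> h (u, 1) = p 1"
  shows "path_homotopic X p q"
  unfolding path_homotopic_iff by (intro exI[of _ h]) (use assms in auto)

lemma path_homotopic_ends:
  assumes "path_homotopic X p q"
  shows "q 0 = p 0" "q 1 = p 1"
  using homotopic_with_imp_property[OF assms[unfolded path_homotopic_def]] by simp_all

lemma path_homotopic_refl: "path_homotopic X p p \<longleftrightarrow> pathin X p"
  by (simp add: path_homotopic_def pathin_def)

lemma path_homotopic_sym:
  assumes "path_homotopic X p q"
  shows "path_homotopic X q p"
  using homotopic_with_symD[OF assms[unfolded path_homotopic_def]] path_homotopic_ends[OF assms]
  by (simp add: path_homotopic_def)

lemma path_homotopic_trans [trans]: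
  assumes "path_homotopic X p q" "path_homotopic X q r"
  shows "path_homotopic X p r"
  using homotopic_with_trans[OF assms[unfolded path_homotopic_def, unfolded path_homotopic_ends[OF assms(1)]]]
  by (simp add: path_homotopic_def)

lemma path_homotopic_cong:
  assumes "pathin X p" "\<And>t. t \<in> {0..1} \<Longrightarrow> p t = q t"
  shows "path_homotopic X p q"
  unfolding path_homotopic_def using assms
  by (intro homotopic_with_equal) (auto simp: pathin_def)

lemma continuous_map_top_of_set_prod:
  "continuous_map (prod_topology (top_of_set A) (top_of_set B)) (top_of_set C) f \<longleftrightarrow>
     continuous_on (A \<times> B) f \<and> f ` (A \<times> B) \<subseteq> C"
  by (simp add: prod_topology_subtopology_eu image_subset_iff_funcset)

text \<open>The laws of the path groupoid (associativity, units, inverses) all say that two paths are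
  reparametrisations \<open>P \<circ> f\<close> and \<open>P \<circ> g\<close> of one map \<open>P\<close> on a convex set of reals. There the straight
  line from \<open>f\<close> to \<open>g\<close> is a homotopy.\<close>

lemma path_homotopic_reparam:
  fixes K :: "real set"
  assumes P: "continuous_map (top_of_set K) X P" and K: "convex K"
    and f: "continuous_on {0..1} f" "f ` {0..1} \<subseteq> K"
    and g: "continuous_on {0..1} g" "g ` {0..1} \<subseteq> K"
    and fg: "f 0 = g 0" "f 1 = g 1"
    and p: "\<And>t. t \<in> {0..1} \<Longrightarrow> p t = P (f t)" and q: "\<And>t. t \<in> {0..1} \<Longrightarrow> q t = P (g t)"
  shows "path_homotopic X p q"
proof (rule path_homotopicI)
  let ?k = "\<lambda>(u, t). (1 - u) *\<^sub>R f t + u *\<^sub>R g t"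
  have "continuous_on ({0..1} \<times> {0..1}) ?k"
    unfolding case_prod_unfold
    by (intro continuous_intros continuous_on_compose2[OF f(1)] continuous_on_compose2[OF g(1)]) auto
  moreover have "(1 - u) *\<^sub>R f t + u *\<^sub>R g t \<in> K" if "u \<in> {0..1}" "t \<in> {0..1}" for u t
  proof -
    have "f t \<in> K" "g t \<in> K" using f(2) g(2) that by blast+
    then show ?thesis using convexD_alt[OF K] that by simp
  qed
  then have "?k ` ({0..1} \<times> {0..1}) \<subseteq> K" by auto
  ultimately show "continuous_map (prod_topology (top_of_set {0..1}) (top_of_set {0..1})) X (P \<circ> ?k)"
    using continuous_map_compose[OF _ P] continuous_map_top_of_set_prod by blast
qed (use p q fg in \<open>auto simp: algebra_simps\<close>)

lemma pathin_topspace: "pathin X p \<Longrightarrow> t \<in> {0..1} \<Longrightarrow> p t \<in> topspace X"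
  by (auto simp: pathin_def continuous_map_def Pi_iff)

lemma path_concat_0 [simp]: "path_concat p q 0 = p 0"
  and path_concat_1 [simp]: "path_concat p q 1 = q 1"
  by (simp_all add: path_concat_def)

lemma path_homotopic_concat:
  assumes p: "path_homotopic X p p'" and q: "path_homotopic X q q'" and e: "p 1 = q 0"
  shows "path_homotopic X (path_concat p q) (path_concat p' q')"
proof -
  let ?I = "top_of_set {0..1::real}"
  obtain h where h: "continuous_map (prod_topology ?I ?I) X h"
    "\<forall>t \<in> {0..1}. h (0, t) = p t \<and> h (1, t) = p' t \<and> h (t, 0) = p 0 \<and> h (t, 1) = p 1"
    using p unfolding path_homotopic_iff by auto
  obtain k where k: "continuous_map (prod_topology ?I ?I) X k"
    "\<forall>t \<in> {0..1}. k (0, t) = q t \<and> k (1, t) = q' t \<and> k (t, 0) = q 0 \<and> k (t, 1) = q 1"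
    using q unfolding path_homotopic_iff by auto
  let ?m = "\<lambda>z::real \<times> real. if snd z \<le> 1/2 then h (fst z, 2 * snd z) else k (fst z, 2 * snd z - 1)"
  have "continuous_map (prod_topology ?I ?I) X ?m"
  proof (rule continuous_map_cases_le)
    show "continuous_map (prod_topology ?I ?I) euclideanreal snd"
      "continuous_map (prod_topology ?I ?I) euclideanreal (\<lambda>z. 1/2)"
      by (auto simp: prod_topology_subtopology_eu continuous_on_snd continuous_on_id)
    have "continuous_map (subtopology (prod_topology ?I ?I) {x \<in> topspace (prod_topology ?I ?I). snd x \<le> 1/2})
        (prod_topology ?I ?I) (\<lambda>z. (fst z, 2 * snd z))"
      unfolding prod_topology_subtopology_eu subtopology_subtopology
      by (auto intro!: continuous_intros)
    from continuous_map_compose[OF this h(1)]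
    show "continuous_map (subtopology (prod_topology ?I ?I) {x \<in> topspace (prod_topology ?I ?I). snd x \<le> 1/2})
        X (\<lambda>z. h (fst z, 2 * snd z))" by (simp add: comp_def)
    have "continuous_map (subtopology (prod_topology ?I ?I) {x \<in> topspace (prod_topology ?I ?I). 1/2 \<le> snd x})
        (prod_topology ?I ?I) (\<lambda>z. (fst z, 2 * snd z - 1))"
      unfolding prod_topology_subtopology_eu subtopology_subtopology
      by (auto intro!: continuous_intros)
    from continuous_map_compose[OF this k(1)]
    show "continuous_map (subtopology (prod_topology ?I ?I) {x \<in> topspace (prod_topology ?I ?I). 1/2 \<le> snd x})
        X (\<lambda>z. k (fst z, 2 * snd z - 1))" by (simp add: comp_def)
    show "h (fst z, 2 * snd z) = k (fst z, 2 * snd z - 1)"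
      if "z \<in> topspace (prod_topology ?I ?I)" "snd z = 1/2" for z
      unfolding that(2) using that(1) h(2) k(2) e by auto
  qed
  then show ?thesis
    by (rule path_homotopicI) (use h(2) k(2) e in \<open>auto simp: path_concat_def\<close>)
qed

lemma pathin_concat:
  assumes "pathin X p" "pathin X q" "p 1 = q 0"
  shows "pathin X (path_concat p q)"
  using path_homotopic_concat[of X p p q q] assms by (simp add: path_homotopic_refl)

definition reverse_path :: "(real \<Rightarrow> 'a) \<Rightarrow> real \<Rightarrow> 'a" where
  "reverse_path p = (\<lambda>t. p (1 - t))"

lemma reverse_path_simps [simp]:
  "reverse_path p 0 = p 1" "reverse_path p 1 = p 0" "reverse_path (reverse_path p) = p"
  by (simp_all add: reverse_path_def)

lemma pathin_reverse:
  assumes "pathin X p"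
  shows "pathin X (reverse_path p)"
proof -
  have "continuous_map (top_of_set {0..1}) (top_of_set {0..1::real}) (\<lambda>t. 1 - t)"
    by (auto intro!: continuous_intros)
  from continuous_map_compose[OF this assms[unfolded pathin_def]]
  show ?thesis by (simp add: pathin_def reverse_path_def comp_def)
qed

lemma path_concat_assoc:
  assumes "pathin X p" "pathin X q" "pathin X r" "p 1 = q 0" "q 1 = r 0"
  shows "path_homotopic X (path_concat (path_concat p q) r) (path_concat p (path_concat q r))"
proof -
  let ?P = "path_concat (path_concat p q) r"
  \<comment> \<open>The parameter of the left-hand path at which the right-hand path is at time \<open>t\<close>.\<close>
  let ?g = "\<lambda>t. if t \<le> 1/2 then t/2 else if t \<le> 3/4 then t - 1/4 else 2 * t - (1::real)"
  show ?thesis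
  proof (rule path_homotopic_reparam[where P = ?P and K = "{0..1}" and f = "\<lambda>t. t" and g = ?g])
    show "continuous_map (top_of_set {0..1}) X ?P"
      using pathin_concat[OF pathin_concat] assms unfolding pathin_def[symmetric] by simp
    have *: "?g = (\<lambda>t. max (t/2) (max (t - 1/4) (2 * t - 1)))" by (auto simp: fun_eq_iff max_def)
    show "continuous_on {0..1} ?g" unfolding * by (auto intro!: continuous_intros)
    show "path_concat p (path_concat q r) t = ?P (?g t)" if "t \<in> {0..1}" for t
      using that by (auto simp: path_concat_def algebra_simps)
  qed (auto intro!: continuous_intros)
qed

lemma path_concat_const_left:
  assumes "pathin X p" "p 0 = x"
  shows "path_homotopic X (path_concat (\<lambda>_. x) p) p"
proof (rule path_homotopic_reparam)
  show "continuous_map (top_of_set {0..1}) X p" using assms(1) by (simp add: pathin_def)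
  show "continuous_on {0..1} (\<lambda>t. max 0 (2 * t - 1::real))" by (intro continuous_intros)
  show "path_concat (\<lambda>_. x) p t = p (max 0 (2 * t - 1))" for t
  proof (cases "t = 1/2")
    case True
    show ?thesis unfolding True using assms(2) by (simp add: path_concat_def)
  qed (use assms(2) in \<open>auto simp: path_concat_def max_def\<close>)
qed (auto intro!: continuous_intros)

lemma path_concat_const_right:
  assumes "pathin X p" "p 1 = x"
  shows "path_homotopic X (path_concat p (\<lambda>_. x)) p"
proof (rule path_homotopic_reparam)
  show "continuous_map (top_of_set {0..1}) X p" using assms(1) by (simp add: pathin_def)
  show "continuous_on {0..1} (\<lambda>t. min 1 (2 * t::real))" by (intro continuous_intros)
  show "path_concat p (\<lambda>_. x) t = p (min 1 (2 * t))" for t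
  proof (cases "t = 1/2")
    case True
    show ?thesis unfolding True using assms(2) by (simp add: path_concat_def)
  qed (use assms(2) in \<open>auto simp: path_concat_def min_def\<close>)
qed (auto intro!: continuous_intros)

lemma path_concat_reverse_right:
  assumes "pathin X p"
  shows "path_homotopic X (path_concat p (reverse_path p)) (\<lambda>_. p 0)"
proof (rule path_homotopic_reparam)
  show "continuous_map (top_of_set {0..1}) X p" using assms(1) by (simp add: pathin_def)
  show "continuous_on {0..1} (\<lambda>t. 1 - \<bar>2 * t - 1\<bar> :: real)" by (intro continuous_intros)
  show "path_concat p (reverse_path p) t = p (1 - \<bar>2 * t - 1\<bar>)" for t
    by (auto simp: path_concat_def reverse_path_def abs_if algebra_simps)
qed (auto simp: abs_if)

lemma path_concat_reverse_left:
  assumes "pathin X p"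
  shows "path_homotopic X (path_concat (reverse_path p) p) (\<lambda>_. p 1)"
  using path_concat_reverse_right[OF pathin_reverse[OF assms]] by simp

section \<open>The fundamental group and change of base point\<close>

definition loop_class :: "'a topology \<Rightarrow> 'a \<Rightarrow> (real \<Rightarrow> 'a) \<Rightarrow> (real \<Rightarrow> 'a) set" where
  "loop_class X x p = loop_homotopy_rel X x `` {p}"

lemma loop_homotopy_rel_iff:
  "(p, q) \<in> loop_homotopy_rel X x \<longleftrightarrow> p \<in> loops X x \<and> q \<in> loops X x \<and> path_homotopic X p q"
  by (auto simp: loop_homotopy_rel_def path_homotopic_def loops_def)

lemma equiv_loop_homotopy_rel: "equiv (loops X x) (loop_homotopy_rel X x)"
proof (rule equivI)
  show "refl_on (loops X x) (loop_homotopy_rel X x)"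
    by (auto simp: refl_on_def loop_homotopy_rel_iff path_homotopic_refl loops_def)
  show "sym (loop_homotopy_rel X x)"
    by (auto simp: sym_def loop_homotopy_rel_iff path_homotopic_sym)
  show "trans (loop_homotopy_rel X x)"
    by (auto simp: trans_def loop_homotopy_rel_iff intro: path_homotopic_trans)
  show "loop_homotopy_rel X x \<subseteq> loops X x \<times> loops X x"
    by (auto simp: loop_homotopy_rel_iff)
qed

lemma loop_class_eq_iff:
  assumes "p \<in> loops X x" "q \<in> loops X x"
  shows "loop_class X x p = loop_class X x q \<longleftrightarrow> path_homotopic X p q"
  using eq_equiv_class_iff[OF equiv_loop_homotopy_rel assms] assms
  by (simp add: loop_class_def loop_homotopy_rel_iff)

lemma carrier_fundamental_group:
  "carrier (fundamental_group X x) = loop_class X x ` loops X x"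
  by (auto simp: fundamental_group_def quotient_def loop_class_def)

lemma loops_concat:
  assumes "p \<in> loops X x" "q \<in> loops X x"
  shows "path_concat p q \<in> loops X x"
  using assms pathin_concat[of X p q] by (auto simp: loops_def)

lemma fundamental_group_mult:
  assumes p: "p \<in> loops X x" and q: "q \<in> loops X x"
  shows "loop_class X x p \<otimes>\<^bsub>fundamental_group X x\<^esub> loop_class X x q = loop_class X x (path_concat p q)"
proof -
  have eq: "loop_homotopy_rel X x `` {path_concat a b} = loop_class X x (path_concat p q)"
    if "a \<in> loop_class X x p" "b \<in> loop_class X x q" for a b
  proof -
    have a: "a \<in> loops X x" "path_homotopic X p a" and b: "b \<in> loops X x" "path_homotopic X q b"
      using that by (auto simp: loop_class_def loop_homotopy_rel_iff)
    have "path_homotopic X (path_concat p q) (path_concat a b)"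
      using a b p q by (intro path_homotopic_concat) (auto simp: loops_def)
    then have "loop_class X x (path_concat p q) = loop_class X x (path_concat a b)"
      using loop_class_eq_iff[OF loops_concat[OF p q] loops_concat[OF a(1) b(1)]] by simp
    then show ?thesis by (simp add: loop_class_def)
  qed
  have "p \<in> loop_class X x p" "q \<in> loop_class X x q"
    using p q by (auto simp: loop_class_def loop_homotopy_rel_iff path_homotopic_refl loops_def)
  then have "(\<Union>a\<in>loop_class X x p. \<Union>b\<in>loop_class X x q. loop_homotopy_rel X x `` {path_concat a b})
      = loop_class X x (path_concat p q)" using eq by blast
  then show ?thesis by (simp add: fundamental_group_def)
qed

lemma fundamental_group_one:
  "\<one>\<^bsub>fundamental_group X x\<^esub> = loop_class X x (\<lambda>_. x)"
  by (simp add: fundamental_group_def loop_class_def)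

lemma const_loop: "x \<in> topspace X \<Longrightarrow> (\<lambda>_. x) \<in> loops X x"
  by (simp add: loops_def pathin_def)

lemma group_fundamental_group:
  assumes x: "x \<in> topspace X"
  shows "group (fundamental_group X x)"
proof (rule groupI)
  fix A B C assume "A \<in> carrier (fundamental_group X x)" "B \<in> carrier (fundamental_group X x)"
    "C \<in> carrier (fundamental_group X x)"
  then obtain p q r where loops: "p \<in> loops X x" "q \<in> loops X x" "r \<in> loops X x"
    and eqs: "A = loop_class X x p" "B = loop_class X x q" "C = loop_class X x r"
    unfolding carrier_fundamental_group by blast
  then show "A \<otimes>\<^bsub>fundamental_group X x\<^esub> B \<otimes>\<^bsub>fundamental_group X x\<^esub> C =
      A \<otimes>\<^bsub>fundamental_group X x\<^esub> (B \<otimes>\<^bsub>fundamental_group X x\<^esub> C)"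
    using path_concat_assoc[of X p q r]
    by (simp add: fundamental_group_mult loops_concat loop_class_eq_iff) (simp add: loops_def)
next
  fix A assume "A \<in> carrier (fundamental_group X x)"
  then obtain p where p: "p \<in> loops X x" "A = loop_class X x p"
    unfolding carrier_fundamental_group by blast
  have p': "pathin X p" "p 0 = x" "p 1 = x" using p by (auto simp: loops_def)
  show "\<one>\<^bsub>fundamental_group X x\<^esub> \<otimes>\<^bsub>fundamental_group X x\<^esub> A = A"
    using path_concat_const_left[OF p'(1,2)] p const_loop[OF x]
    by (simp add: fundamental_group_one fundamental_group_mult loops_concat loop_class_eq_iff)
  have r: "reverse_path p \<in> loops X x" using p' pathin_reverse by (auto simp: loops_def)
  then have "loop_class X x (reverse_path p) \<otimes>\<^bsub>fundamental_group X x\<^esub> A = \<one>\<^bsub>fundamental_group X x\<^esub>"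
    using path_concat_reverse_left[OF p'(1)] p p' const_loop[OF x]
    by (simp add: fundamental_group_one fundamental_group_mult loops_concat loop_class_eq_iff)
  then show "\<exists>B \<in> carrier (fundamental_group X x). B \<otimes>\<^bsub>fundamental_group X x\<^esub> A = \<one>\<^bsub>fundamental_group X x\<^esub>"
    using r by (auto simp: carrier_fundamental_group)
qed (auto simp: carrier_fundamental_group fundamental_group_mult fundamental_group_one
       loops_concat const_loop[OF x])

text \<open>Conjugation by \<open>c\<close> carries loops at the end of \<open>c\<close> to loops at its start; the next lemmas say that
  on homotopy classes it is multiplicative and bijective, so base points can be moved.\<close>

definition conjugate_path :: "(real \<Rightarrow> 'a) \<Rightarrow> (real \<Rightarrow> 'a) \<Rightarrow> real \<Rightarrow> 'a" where
  "conjugate_path c p = path_concat c (path_concat p (reverse_path c))"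

lemma conjugate_path_loop:
  assumes "pathin X c" "p \<in> loops X (c 1)"
  shows "conjugate_path c p \<in> loops X (c 0)"
  using assms pathin_reverse[OF assms(1)]
  by (auto simp: conjugate_path_def loops_def intro!: pathin_concat)

lemma conjugate_path_homotopic:
  assumes "pathin X c" "path_homotopic X p q" "p \<in> loops X (c 1)"
  shows "path_homotopic X (conjugate_path c p) (conjugate_path c q)"
  unfolding conjugate_path_def using assms pathin_reverse[OF assms(1)]
  by (intro path_homotopic_concat) (auto simp: loops_def path_homotopic_refl)

text \<open>The inner factors \<open>c\<^sup>-\<^sup>1 c\<close> cancel.\<close>

lemma conjugate_path_concat:
  assumes c: "pathin X c" and p: "p \<in> loops X (c 1)" and q: "q \<in> loops X (c 1)"
  shows "path_homotopic X (path_concat (conjugate_path c p) (conjugate_path c q))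
           (conjugate_path c (path_concat p q))"
proof -
  let ?c = "reverse_path c"
  note [intro!] = pathin_concat pathin_reverse[OF c] c
  have [simp, intro]: "pathin X p" "p 0 = c 1" "p 1 = c 1" "pathin X q" "q 0 = c 1" "q 1 = c 1"
    using p q by (auto simp: loops_def)
  note congR = path_homotopic_concat[OF path_homotopic_refl[THEN iffD2]]
  note congL = path_homotopic_concat[OF _ path_homotopic_refl[THEN iffD2]]
  have "path_homotopic X (path_concat (conjugate_path c p) (conjugate_path c q))
      (path_concat c (path_concat (path_concat p ?c) (path_concat c (path_concat q ?c))))"
    unfolding conjugate_path_def by (intro path_concat_assoc) auto
  also have "path_homotopic X \<dots> (path_concat c (path_concat p (path_concat q ?c)))"
  proof (intro congR)
    have "path_homotopic X (path_concat (path_concat p ?c) (path_concat c (path_concat q ?c)))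
       (path_concat p (path_concat ?c (path_concat c (path_concat q ?c))))"
      by (intro path_concat_assoc) auto
    also have "path_homotopic X \<dots> (path_concat p (path_concat q ?c))"
    proof (intro congR)
      have "path_homotopic X (path_concat ?c (path_concat c (path_concat q ?c)))
          (path_concat (path_concat ?c c) (path_concat q ?c))"
        by (intro path_homotopic_sym[OF path_concat_assoc]) auto
      also have "path_homotopic X \<dots> (path_concat (\<lambda>_. c 1) (path_concat q ?c))"
        using path_concat_reverse_left[OF c] by (intro congL) auto
      also have "path_homotopic X \<dots> (path_concat q ?c)"
        by (intro path_concat_const_left) auto
      finally show "path_homotopic X (path_concat ?c (path_concat c (path_concat q ?c))) (path_concat q ?c)" .
    qed auto
    finally show "path_homotopic X (path_concat (path_concat p ?c) (path_concat c (path_concat q ?c)))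
      (path_concat p (path_concat q ?c))" .
  qed auto
  also have "path_homotopic X \<dots> (conjugate_path c (path_concat p q))"
    unfolding conjugate_path_def
    by (intro congR path_homotopic_sym[OF path_concat_assoc]) auto
  finally show ?thesis .
qed

lemma conjugate_path_inverse:
  assumes c: "pathin X c" and p: "p \<in> loops X (c 1)"
  shows "path_homotopic X (conjugate_path (reverse_path c) (conjugate_path c p)) p"
proof -
  let ?c = "reverse_path c"
  note [intro!] = pathin_concat pathin_reverse[OF c] c
  have [simp, intro]: "pathin X p" "p 0 = c 1" "p 1 = c 1"
    using p by (auto simp: loops_def)
  note congR = path_homotopic_concat[OF path_homotopic_refl[THEN iffD2]]
  note congL = path_homotopic_concat[OF _ path_homotopic_refl[THEN iffD2]]
  have "path_homotopic X (path_concat (path_concat c (path_concat p ?c)) c)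
     (path_concat c (path_concat (path_concat p ?c) c))"
    by (intro path_concat_assoc) auto
  also have "path_homotopic X \<dots> (path_concat c p)"
  proof (intro congR)
    have "path_homotopic X (path_concat (path_concat p ?c) c) (path_concat p (path_concat ?c c))"
      by (intro path_concat_assoc) auto
    also have "path_homotopic X \<dots> (path_concat p (\<lambda>_. c 1))"
      using path_concat_reverse_left[OF c] by (intro congR) auto
    also have "path_homotopic X \<dots> p" by (intro path_concat_const_right) auto
    finally show "path_homotopic X (path_concat (path_concat p ?c) c) p" .
  qed auto
  finally have "path_homotopic X (path_concat (path_concat c (path_concat p ?c)) c) (path_concat c p)" .
  then have "path_homotopic X (conjugate_path ?c (conjugate_path c p)) (path_concat ?c (path_concat c p))"
    unfolding conjugate_path_def reverse_path_simps by (intro congR) auto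
  also have "path_homotopic X \<dots> (path_concat (path_concat ?c c) p)"
    by (intro path_homotopic_sym[OF path_concat_assoc]) auto
  also have "path_homotopic X \<dots> (path_concat (\<lambda>_. c 1) p)"
    using path_concat_reverse_left[OF c] by (intro congL) auto
  also have "path_homotopic X \<dots> p" by (intro path_concat_const_left) auto
  finally show ?thesis .
qed

lemma conjugate_path_homotopic_iff:
  assumes c: "pathin X c" and p: "p \<in> loops X (c 1)" and q: "q \<in> loops X (c 1)"
  shows "path_homotopic X (conjugate_path c p) (conjugate_path c q) \<longleftrightarrow> path_homotopic X p q"
proof
  assume h: "path_homotopic X (conjugate_path c p) (conjugate_path c q)"
  have "path_homotopic X (conjugate_path (reverse_path c) (conjugate_path c p))
      (conjugate_path (reverse_path c) (conjugate_path c q))"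
    using conjugate_path_homotopic[OF pathin_reverse[OF c] h] conjugate_path_loop[OF c p] by simp
  then show "path_homotopic X p q"
    using conjugate_path_inverse[OF c p] conjugate_path_inverse[OF c q]
    by (meson path_homotopic_sym path_homotopic_trans)
qed (rule conjugate_path_homotopic[OF c _ p])

section \<open>The covering of a mapping torus by a product\<close>

lemma continuous_integer_valued_constant:
  fixes f :: "'a::topological_space \<Rightarrow> real"
  assumes "connected S" "continuous_on S f" "f ` S \<subseteq> \<int>" "a \<in> S" "b \<in> S"
  shows "f a = f b"
proof -
  have "f constant_on S"
  proof (rule continuous_discrete_range_constant[OF assms(1,2)])
    fix x assume x: "x \<in> S"
    have "1 \<le> norm (f y - f x)" if "y \<in> S" "f y \<noteq> f x" for y
    proof -
      have "f y \<in> \<int>" "f x \<in> \<int>" using assms(3) x that(1) by blast+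
      then have "f y - f x \<in> \<int>" by (rule Ints_diff)
      then show ?thesis using Ints_nonzero_abs_ge1[of "f y - f x"] that(2) by simp
    qed
    then show "\<exists>e>0. \<forall>y. y \<in> S \<and> f y \<noteq> f x \<longrightarrow> e \<le> norm (f y - f x)"
      using zero_less_one by blast
  qed
  then show ?thesis using assms(4,5) by (auto simp: constant_on_def)
qed

text \<open>An action of the integers is the convenient form of a homeomorphism together with all its iterates,
  since the covering of the mapping torus of \<open>\<rho> 1\<close> needs the negative ones too.\<close>

locale integer_action =
  fixes F :: "'a topology" and \<rho> :: "int \<Rightarrow> 'a \<Rightarrow> 'a"
  assumes continuous_action: "continuous_map F F (\<rho> d)"
    and action_0: "x \<in> topspace F \<Longrightarrow> \<rho> 0 x = x"
    and action_add: "x \<in> topspace F \<Longrightarrow> \<rho> (c + d) x = \<rho> c (\<rho> d x)"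
begin

lemma action_closed [simp]: "x \<in> topspace F \<Longrightarrow> \<rho> d x \<in> topspace F"
  using continuous_map_image_subset_topspace[OF continuous_action] by blast

lemma action_inverse [simp]:
  assumes "x \<in> topspace F"
  shows "\<rho> (- d) (\<rho> d x) = x" "\<rho> d (\<rho> (- d) x) = x"
  using action_add[OF assms, of "- d" d] action_add[OF assms, of d "- d"] action_0[OF assms] by auto

abbreviation "torus \<equiv> mapping_torus F (\<rho> 1)"
abbreviation "torus_rel \<equiv> mapping_torus_rel F (\<rho> 1)"
abbreviation "cylinder \<equiv> prod_topology F (top_of_set {0..1::real})"
abbreviation "cover \<equiv> prod_topology F euclideanreal"

text \<open>The relation glues only \<open>(x, 1)\<close> to \<open>(\<rho> 1 x, 0)\<close>, so every class has exactly one point of height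
  different from \<open>1\<close>.\<close>

definition torus_normal_form :: "'a \<times> real \<Rightarrow> 'a \<times> real" where
  "torus_normal_form p = (if snd p = 1 then (\<rho> 1 (fst p), 0) else p)"

lemma torus_rel_iff:
  "(p, q) \<in> torus_rel \<longleftrightarrow> p \<in> topspace cylinder \<and> q \<in> topspace cylinder \<and>
     torus_normal_form p = torus_normal_form q"
proof -
  let ?R = "\<lambda>u v. \<exists>x \<in> topspace F. u = (\<rho> 1 x, 0::real) \<and> v = (x, 1)"
  have "torus_normal_form p = torus_normal_form q" if "equivclp ?R p q"
    using that by (induction rule: equivclp_induct) (auto simp: torus_normal_form_def)
  moreover have "equivclp ?R p q" if p: "p \<in> topspace cylinder" and q: "q \<in> topspace cylinder"
    and eq: "torus_normal_form p = torus_normal_form q"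
  proof -
    have *: "equivclp ?R z (torus_normal_form z)" if "z \<in> topspace cylinder" for z
    proof (cases "snd z = 1")
      case True
      then have "?R (torus_normal_form z) z" using that by (auto simp: torus_normal_form_def)
      then show ?thesis by (rule converse_r_into_equivclp)
    qed (simp add: torus_normal_form_def)
    have "equivclp ?R p (torus_normal_form q)" using *[OF p] eq by simp
    then show ?thesis using equivclp_sym[OF *[OF q]] by (rule equivclp_trans)
  qed
  ultimately show ?thesis by (auto simp: mapping_torus_rel_def)
qed

lemma equiv_torus_rel: "equiv (topspace cylinder) torus_rel"
  by (rule equivI) (auto simp: refl_on_def sym_def trans_def torus_rel_iff)

lemma topspace_torus: "topspace torus = topspace cylinder // torus_rel"
  unfolding mapping_torus_def by (rule topspace_quotient_topology)

lemma openin_torus: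
  "openin torus U \<longleftrightarrow> U \<subseteq> topspace cylinder // torus_rel \<and>
     openin cylinder {z \<in> topspace cylinder. torus_rel `` {z} \<in> U}"
  unfolding mapping_torus_def by (rule openin_quotient_topology)

lemma continuous_map_torus_class: "continuous_map cylinder torus (\<lambda>z. torus_rel `` {z})"
  unfolding continuous_map_def topspace_torus by (auto simp: openin_torus intro!: quotientI)

text \<open>The point \<open>(x, s)\<close> is moved into the cylinder by the translation through \<open>-\<lfloor>s\<rfloor>\<close>, which acts on the
  fibre by \<open>\<rho> \<lfloor>s\<rfloor>\<close>: passing the gluing upwards applies \<open>\<rho> 1\<close>.\<close>

definition covering_proj :: "'a \<times> real \<Rightarrow> ('a \<times> real) set" where
  "covering_proj z = torus_rel `` {(\<rho> \<lfloor>snd z\<rfloor> (fst z), frac (snd z))}"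

lemma torus_class_eq_iff:
  assumes "p \<in> topspace cylinder" "q \<in> topspace cylinder"
  shows "torus_rel `` {p} = torus_rel `` {q} \<longleftrightarrow> torus_normal_form p = torus_normal_form q"
  using eq_equiv_class_iff[OF equiv_torus_rel assms] torus_rel_iff assms by blast

lemma frac_cylinder: "x \<in> topspace F \<Longrightarrow> (\<rho> d x, frac s) \<in> topspace cylinder"
  by (simp add: frac_ge_0 less_imp_le[OF frac_lt_1])

text \<open>The fibres of the projection are the orbits of the translations \<open>(x, s) \<mapsto> (\<rho> d x, s - d)\<close>.\<close>

lemma covering_proj_eq_iff:
  assumes x: "x \<in> topspace F" and y: "y \<in> topspace F"
  shows "covering_proj (x, s) = covering_proj (y, t) \<longleftrightarrow> (\<exists>d. s = t + of_int d \<and> y = \<rho> d x)"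
proof -
  have "frac s \<noteq> 1" "frac t \<noteq> 1" using frac_lt_1 less_irrefl by metis+
  then have "covering_proj (x, s) = covering_proj (y, t) \<longleftrightarrow>
      \<rho> \<lfloor>s\<rfloor> x = \<rho> \<lfloor>t\<rfloor> y \<and> frac s = frac t"
    unfolding covering_proj_def
    by (subst torus_class_eq_iff) (use frac_cylinder x y in \<open>auto simp: torus_normal_form_def\<close>)
  also have "\<dots> \<longleftrightarrow> (\<exists>d. s = t + of_int d \<and> y = \<rho> d x)"
  proof
    assume h: "\<rho> \<lfloor>s\<rfloor> x = \<rho> \<lfloor>t\<rfloor> y \<and> frac s = frac t"
    have "\<rho> (\<lfloor>s\<rfloor> - \<lfloor>t\<rfloor>) x = \<rho> (- \<lfloor>t\<rfloor>) (\<rho> \<lfloor>s\<rfloor> x)"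
      using action_add[OF x, of "- \<lfloor>t\<rfloor>" "\<lfloor>s\<rfloor>"] by simp
    also have "\<dots> = y" using h y by simp
    finally have "y = \<rho> (\<lfloor>s\<rfloor> - \<lfloor>t\<rfloor>) x" by simp
    moreover have "s = t + of_int (\<lfloor>s\<rfloor> - \<lfloor>t\<rfloor>)" using h by (simp add: frac_def)
    ultimately show "\<exists>d. s = t + of_int d \<and> y = \<rho> d x" by blast
  next
    assume "\<exists>d. s = t + of_int d \<and> y = \<rho> d x"
    then obtain d where d: "s = t + of_int d" "y = \<rho> d x" by blast
    then show "\<rho> \<lfloor>s\<rfloor> x = \<rho> \<lfloor>t\<rfloor> y \<and> frac s = frac t"
      using action_add[OF x, of "\<lfloor>t\<rfloor>" d] by (simp add: frac_def)
  qed
  finally show ?thesis .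
qed

lemma covering_proj_eqE:
  assumes "covering_proj (x, s) = covering_proj (y, t)" "x \<in> topspace F" "y \<in> topspace F"
  obtains d where "s = t + of_int d" "y = \<rho> d x"
  using assms covering_proj_eq_iff[OF assms(2,3)] by blast

lemma covering_proj_shift:
  assumes "x \<in> topspace F"
  shows "covering_proj (\<rho> (- d) x, s + of_int d) = covering_proj (x, s)"
  using assms by (subst covering_proj_eq_iff) (auto intro!: exI[of _ d])

lemma covering_proj_cylinder:
  assumes "z \<in> topspace cylinder"
  shows "covering_proj z = torus_rel `` {z}"
proof (cases "snd z = 1")
  case True
  then show ?thesis
    unfolding covering_proj_def
    by (subst torus_class_eq_iff) (use assms in \<open>auto simp: torus_normal_form_def frac_def\<close>)
next
  case False
  then have "0 \<le> snd z" "snd z < 1" "fst z \<in> topspace F" using assms by auto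
  then have "\<lfloor>snd z\<rfloor> = 0" "frac (snd z) = snd z" "\<rho> 0 (fst z) = fst z"
    by (auto simp: floor_eq_iff frac_eq action_0)
  then show ?thesis by (simp add: covering_proj_def)
qed

lemma topspace_torus_covering: "topspace torus = covering_proj ` topspace cover"
proof
  show "topspace torus \<subseteq> covering_proj ` topspace cover"
  proof
    fix C assume "C \<in> topspace torus"
    then obtain z where "z \<in> topspace cylinder" "C = torus_rel `` {z}"
      unfolding topspace_torus by (auto elim!: quotientE)
    then show "C \<in> covering_proj ` topspace cover"
      using covering_proj_cylinder[of z] by (intro image_eqI[of _ _ z]) auto
  qed
  show "covering_proj ` topspace cover \<subseteq> topspace torus"
    unfolding topspace_torus covering_proj_def
    using frac_cylinder by (auto intro!: quotientI)
qed

text \<open>The floor jumps at integer heights. On each closed slab between consecutive integers the projection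
  is a translation into the cylinder followed by the class map, also at the upper end, where the
  translated height is \<open>1\<close>; these slabs form a locally finite cover.\<close>

lemma continuous_map_covering_proj: "continuous_map cover torus covering_proj"
proof (rule pasting_lemma_locally_finite[where I = "UNIV :: int set"
      and T = "\<lambda>m. topspace F \<times> {of_int m .. of_int m + 1}"
      and f = "\<lambda>m z. torus_rel `` {(\<rho> m (fst z), snd z - of_int m)}"])
  have eq: "torus_rel `` {(\<rho> m (fst z), snd z - of_int m)} = covering_proj z"
    if z: "z \<in> topspace F \<times> {of_int m .. of_int m + 1}" for m z
  proof -
    have "torus_rel `` {(\<rho> m (fst z), snd z - of_int m)} = covering_proj (\<rho> m (fst z), snd z - of_int m)"
      using z by (subst covering_proj_cylinder) auto
    also have "\<dots> = covering_proj z"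
      using z covering_proj_shift[of "fst z" "- m" "snd z"] by auto
    finally show ?thesis .
  qed
  fix i j :: int and z
  show "torus_rel `` {(\<rho> i (fst z), snd z - of_int i)} = torus_rel `` {(\<rho> j (fst z), snd z - of_int j)}"
    if "z \<in> topspace cover \<inter> (topspace F \<times> {of_int i .. of_int i + 1}) \<inter>
        (topspace F \<times> {of_int j .. of_int j + 1})"
    using that eq[of z i] eq[of z j] by auto
  show "\<exists>m. m \<in> UNIV \<and> z \<in> topspace F \<times> {of_int m .. of_int m + 1} \<and>
      covering_proj z = torus_rel `` {(\<rho> m (fst z), snd z - of_int m)}" if "z \<in> topspace cover"
  proof -
    have "z \<in> topspace F \<times> {of_int \<lfloor>snd z\<rfloor> .. of_int \<lfloor>snd z\<rfloor> + 1}"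
      using that by (cases z) (auto intro: real_of_int_floor_add_one_ge)
    then show ?thesis using eq by blast
  qed
  show "closedin cover (topspace F \<times> {of_int i .. of_int i + 1})"
    by (simp add: closedin_prod_Times_iff)
  show "continuous_map (subtopology cover (topspace F \<times> {of_int i .. of_int i + 1})) torus
      (\<lambda>z. torus_rel `` {(\<rho> i (fst z), snd z - of_int i)})"
  proof -
    let ?T = "subtopology cover (topspace F \<times> {of_int i .. of_int i + 1})"
    have "continuous_map ?T F (\<rho> i \<circ> fst)"
      by (intro continuous_map_compose[OF _ continuous_action] continuous_map_from_subtopology
          continuous_map_fst)
    moreover have "continuous_map ?T (top_of_set {0..1}) (\<lambda>z. snd z - of_int i)"
      unfolding continuous_map_in_subtopology
      by (auto intro!: continuous_map_diff continuous_map_from_subtopology continuous_map_snd)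
    ultimately have "continuous_map ?T cylinder (\<lambda>z. (\<rho> i (fst z), snd z - of_int i))"
      by (simp add: continuous_map_paired comp_def)
    from continuous_map_compose[OF this continuous_map_torus_class]
    show ?thesis by (simp add: comp_def)
  qed
  show "\<exists>V. openin cover V \<and> z \<in> V \<and> finite {m \<in> UNIV. topspace F \<times> {of_int m .. of_int m + 1} \<inter> V \<noteq> {}}"
    if "z \<in> topspace cover"
  proof (intro exI conjI)
    let ?V = "topspace F \<times> {snd z - 1 <..< snd z + 1}"
    show "openin cover ?V" by (simp add: openin_prod_Times_iff)
    show "z \<in> ?V" using that by (cases z) auto
    have "{m \<in> UNIV. topspace F \<times> {of_int m .. of_int m + 1} \<inter> ?V \<noteq> {}} \<subseteq> {\<lfloor>snd z\<rfloor> - 2 .. \<lfloor>snd z\<rfloor> + 2}"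
    proof
      fix m :: int assume "m \<in> {m \<in> UNIV. topspace F \<times> {of_int m .. of_int m + 1} \<inter> ?V \<noteq> {}}"
      then obtain s where "of_int m \<le> s" "s \<le> of_int m + 1" "snd z - 1 < s" "s < snd z + 1" by auto
      then show "m \<in> {\<lfloor>snd z\<rfloor> - 2 .. \<lfloor>snd z\<rfloor> + 2}" by simp linarith
    qed
    then show "finite {m \<in> UNIV. topspace F \<times> {of_int m .. of_int m + 1} \<inter> ?V \<noteq> {}}"
      by (rule finite_subset) simp
  qed
qed

text \<open>The preimage in the cylinder of the image of \<open>W\<close> is the union of the translates of \<open>W\<close>.\<close>

lemma open_map_covering_proj: "open_map cover torus covering_proj"
  unfolding open_map_def
proof (intro allI impI)
  fix W assume W: "openin cover W"
  have "covering_proj ` W \<subseteq> topspace torus"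
    unfolding topspace_torus_covering using openin_subset[OF W] by (rule image_mono)
  moreover have "{z \<in> topspace cylinder. torus_rel `` {z} \<in> covering_proj ` W} =
      (\<Union>d. {z \<in> topspace cylinder. (\<rho> d (fst z), snd z - of_int d) \<in> W})" (is "?L = ?R")
  proof (rule Set.set_eqI, rule iffI)
    fix z assume "z \<in> ?L"
    then obtain w where z: "z \<in> topspace cylinder" and w: "w \<in> W" "covering_proj z = covering_proj w"
      using covering_proj_cylinder by auto
    moreover have "fst w \<in> topspace F" "fst z \<in> topspace F"
      using openin_subset[OF W] w(1) z by auto
    ultimately obtain d where "snd z = snd w + of_int d" "fst w = \<rho> d (fst z)"
      using covering_proj_eq_iff[of "fst z" "fst w" "snd z" "snd w"] by auto
    then have "(\<rho> d (fst z), snd z - of_int d) = w" by (simp add: prod_eq_iff)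
    then have "(\<rho> d (fst z), snd z - of_int d) \<in> W" using w(1) by (rule ssubst)
    then show "z \<in> ?R" using z by blast
  next
    fix z assume "z \<in> ?R"
    then obtain d where z: "z \<in> topspace cylinder" and w: "(\<rho> d (fst z), snd z - of_int d) \<in> W" by auto
    have "fst z \<in> topspace F" using z by auto
    from covering_proj_shift[OF this, of "- d" "snd z"]
    have "covering_proj (\<rho> d (fst z), snd z - of_int d) = torus_rel `` {z}"
      by (simp add: covering_proj_cylinder[OF z])
    from this[symmetric] w have "torus_rel `` {z} \<in> covering_proj ` W" by (rule image_eqI)
    then show "z \<in> ?L" using z by blast
  qed
  moreover have "openin cylinder ?R"
  proof (intro openin_Union ballI)
    have "openin cylinder {z \<in> topspace cylinder. (\<rho> d (fst z), snd z - of_int d) \<in> W}" for d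
    proof -
      have "continuous_map cylinder F (\<rho> d \<circ> fst)"
        by (intro continuous_map_compose[OF _ continuous_action] continuous_map_fst)
      moreover have "continuous_map cylinder euclideanreal (\<lambda>z. snd z - of_int d)"
        using continuous_map_snd[of F "top_of_set {0..1::real}"]
        by (auto intro!: continuous_map_diff simp: continuous_map_in_subtopology)
      ultimately have "continuous_map cylinder cover (\<lambda>z. (\<rho> d (fst z), snd z - of_int d))"
        by (simp add: continuous_map_paired comp_def)
      then show ?thesis using W by (rule openin_continuous_map_preimage)
    qed
    then show "openin cylinder S"
      if "S \<in> range (\<lambda>d. {z \<in> topspace cylinder. (\<rho> d (fst z), snd z - of_int d) \<in> W})" for S
      using that by blast
  qed
  ultimately show "openin torus (covering_proj ` W)"
    unfolding openin_torus topspace_torus by simp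
qed

lemma quotient_map_covering_proj: "quotient_map cover torus covering_proj"
  using continuous_open_imp_quotient_map[OF continuous_map_covering_proj open_map_covering_proj]
    topspace_torus_covering by simp

text \<open>The height modulo \<open>1\<close> makes the mapping torus a bundle over the circle.\<close>

lemma circle_coordinate:
  obtains \<theta> where "continuous_map torus euclidean \<theta>"
    "\<And>x s. x \<in> topspace F \<Longrightarrow> \<theta> (covering_proj (x, s)) = cis (2 * pi * s)"
proof -
  have c: "continuous_map cover euclidean (\<lambda>z. cis (2 * pi * snd z))"
  proof -
    have "continuous_map euclideanreal euclidean (\<lambda>s. cis (2 * pi * s))"
      by (auto intro!: continuous_intros)
    from continuous_map_compose[OF continuous_map_snd this]
    show ?thesis by (simp add: comp_def)
  qed
  have "cis (2 * pi * snd z) = cis (2 * pi * snd w)"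
    if "z \<in> topspace cover" "w \<in> topspace cover" "covering_proj z = covering_proj w" for z w
  proof -
    have "fst z \<in> topspace F" "fst w \<in> topspace F" using that(1,2) by auto
    moreover have "covering_proj (fst z, snd z) = covering_proj (fst w, snd w)" using that(3) by simp
    ultimately obtain d where "snd z = snd w + of_int d" by (metis covering_proj_eqE)
    then have "cis (2 * pi * snd z) = cis (2 * pi * snd w) * cis (2 * pi * of_int d)"
      by (simp add: cis_mult algebra_simps)
    then show ?thesis by simp
  qed
  then obtain \<theta> where "continuous_map torus euclidean \<theta>"
      "\<And>z. z \<in> topspace cover \<Longrightarrow> \<theta> (covering_proj z) = cis (2 * pi * snd z)"
    using quotient_map_lift_exists[OF quotient_map_covering_proj c] by metis
  then show ?thesis using that by force
qed

text \<open>The height of a lift is a logarithm of the circle coordinate along \<open>\<gamma>\<close>, which exists on a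
  contractible domain. The height determines the point of the fibre, and that point depends
  continuously on the parameter because the projection is open and injective on pieces of height less
  than \<open>1\<close>. Taking the square as domain gives the lifting of homotopies.\<close>

lemma lift_exists:
  fixes \<gamma> :: "'b::real_normed_vector \<Rightarrow> ('a \<times> real) set"
  assumes \<gamma>: "continuous_map (top_of_set K) torus \<gamma>" and K: "contractible K"
    and a: "a \<in> K" "x \<in> topspace F" "\<gamma> a = covering_proj (x, s)"
  obtains \<xi> \<sigma> where "continuous_map (top_of_set K) F \<xi>" "continuous_on K \<sigma>"
    "\<And>t. t \<in> K \<Longrightarrow> \<gamma> t = covering_proj (\<xi> t, \<sigma> t)" "\<xi> a = x" "\<sigma> a = s"
proof -
  obtain \<theta> where \<theta>: "continuous_map torus euclidean \<theta>"
    "\<And>x s. x \<in> topspace F \<Longrightarrow> \<theta> (covering_proj (x, s)) = cis (2 * pi * s)"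
    using circle_coordinate by blast
  have \<gamma>_rep: "\<exists>y u. y \<in> topspace F \<and> \<gamma> t = covering_proj (y, u)" if "t \<in> K" for t
  proof -
    have "\<gamma> t \<in> topspace torus" using \<gamma> that by (auto simp: continuous_map_def Pi_iff)
    then show ?thesis unfolding topspace_torus_covering by auto
  qed
  have "continuous_on K (\<theta> \<circ> \<gamma>)" using continuous_map_compose[OF \<gamma> \<theta>(1)] by simp
  moreover have "(\<theta> \<circ> \<gamma>) t \<noteq> 0" if "t \<in> K" for t using \<gamma>_rep[OF that] \<theta>(2) by auto
  ultimately obtain g where g: "continuous_on K g" "\<And>t. t \<in> K \<Longrightarrow> (\<theta> \<circ> \<gamma>) t = exp (g t)"
    using continuous_logarithm_on_contractible[OF _ K] by metis
  \<comment> \<open>The height along the path, up to an integer that is corrected at the end.\<close>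
  define \<tau> where "\<tau> t = Im (g t) / (2 * pi)" for t
  have \<tau>: "continuous_on K \<tau>" unfolding \<tau>_def by (intro continuous_intros g) auto
  have "\<exists>y. y \<in> topspace F \<and> \<gamma> t = covering_proj (y, \<tau> t)" if t: "t \<in> K" for t
  proof -
    obtain y u where y: "y \<in> topspace F" "\<gamma> t = covering_proj (y, u)" using \<gamma>_rep[OF t] by blast
    have "exp (g t) = exp (\<i> * of_real (2 * pi * u))"
      using g(2)[OF t] y \<theta>(2) by (simp add: cis_conv_exp)
    then obtain n :: int where "g t = \<i> * of_real (2 * pi * u) + (of_int (2 * n) * pi) * \<i>"
      unfolding exp_eq by blast
    then have "Im (g t) = 2 * pi * u + 2 * of_int n * pi" by simp
    then have "\<tau> t = u + of_int n" by (simp add: \<tau>_def field_simps)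
    then have "covering_proj (\<rho> (- n) y, \<tau> t) = \<gamma> t" using covering_proj_shift[OF y(1)] y(2) by simp
    then show ?thesis using y(1) by (intro exI[of _ "\<rho> (- n) y"]) simp
  qed
  then obtain \<eta> where \<eta>: "\<And>t. t \<in> K \<Longrightarrow> \<eta> t \<in> topspace F"
    "\<And>t. t \<in> K \<Longrightarrow> \<gamma> t = covering_proj (\<eta> t, \<tau> t)" by metis
  have \<eta>_cont: "continuous_map (top_of_set K) F \<eta>"
    unfolding continuous_map_eq_topcontinuous_at topcontinuous_at_def
  proof (intro ballI conjI allI impI)
    fix t0 V assume t0: "t0 \<in> topspace (top_of_set K)" and V: "openin F V \<and> \<eta> t0 \<in> V"
    \<comment> \<open>Heights in this interval that agree modulo \<open>1\<close> are equal.\<close>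
    let ?B = "{\<tau> t0 - 1/4 <..< \<tau> t0 + 1/4}"
    have "openin cover (V \<times> ?B)" using V by (simp add: openin_prod_Times_iff)
    then have "openin torus (covering_proj ` (V \<times> ?B))"
      using open_map_covering_proj by (simp add: open_map_def)
    then have "openin (top_of_set K) {t \<in> topspace (top_of_set K). \<gamma> t \<in> covering_proj ` (V \<times> ?B)}"
      by (rule openin_continuous_map_preimage[OF \<gamma>])
    moreover have "continuous_map (top_of_set K) euclideanreal \<tau>" using \<tau> by simp
    then have "openin (top_of_set K) {t \<in> topspace (top_of_set K). \<tau> t \<in> ?B}"
      by (rule openin_continuous_map_preimage) simp
    ultimately have "openin (top_of_set K) ({t \<in> topspace (top_of_set K). \<gamma> t \<in> covering_proj ` (V \<times> ?B)} \<inter>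
        {t \<in> topspace (top_of_set K). \<tau> t \<in> ?B})" (is "openin _ ?U") by (rule openin_Int)
    moreover have "t0 \<in> ?U" using t0 V \<eta>(2) by auto
    moreover have "\<eta> t \<in> V" if "t \<in> ?U" for t
    proof -
      have "\<gamma> t \<in> covering_proj ` (V \<times> ?B)" using that by blast
      then obtain v u where v: "v \<in> V" "u \<in> ?B" "\<gamma> t = covering_proj (v, u)" by blast
      have t: "t \<in> K" "\<tau> t \<in> ?B" using that by auto
      have vF: "v \<in> topspace F" using V v(1) openin_subset by blast
      obtain d :: int where d: "\<tau> t = u + of_int d" "v = \<rho> d (\<eta> t)"
        using covering_proj_eqE[OF _ \<eta>(1)[OF t(1)] vF] \<eta>(2)[OF t(1)] v(3) by metis
      then have "\<bar>of_int d :: real\<bar> < 1" using t(2) v(2) by auto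
      then have "d = 0" by linarith
      then show ?thesis using d(2) v(1) action_0[OF \<eta>(1)[OF t(1)]] by simp
    qed
    ultimately show "\<exists>U. openin (top_of_set K) U \<and> t0 \<in> U \<and> (\<forall>t\<in>U. \<eta> t \<in> V)" by blast
  qed (use \<eta> in auto)
  \<comment> \<open>A translation moves the lift to the prescribed starting point.\<close>
  obtain e :: int where e: "s = \<tau> a + of_int e" "\<eta> a = \<rho> e x"
    using covering_proj_eq_iff[OF a(2) \<eta>(1)[OF a(1)]] \<eta>(2)[OF a(1)] a(3) by metis
  show ?thesis
  proof (rule that)
    show "continuous_map (top_of_set K) F (\<rho> (- e) \<circ> \<eta>)"
      by (rule continuous_map_compose[OF \<eta>_cont continuous_action])
    show "continuous_on K (\<lambda>t. \<tau> t + of_int e)" by (intro continuous_intros \<tau>)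
    show "\<gamma> t = covering_proj ((\<rho> (- e) \<circ> \<eta>) t, \<tau> t + of_int e)" if "t \<in> K" for t
      using covering_proj_shift \<eta>[OF that] by simp
    show "(\<rho> (- e) \<circ> \<eta>) a = x" "\<tau> a + of_int e = s" using e a(2) by simp_all
  qed
qed

text \<open>The heights of two lifts differ by a continuous integer-valued function.\<close>

lemma lift_unique:
  fixes S :: "'b::topological_space set"
  assumes S: "connected S" and \<sigma>: "continuous_on S \<sigma>" "continuous_on S \<sigma>'"
    and eq: "\<And>t. t \<in> S \<Longrightarrow> covering_proj (\<xi> t, \<sigma> t) = covering_proj (\<xi>' t, \<sigma>' t)"
    and \<xi>: "\<And>t. t \<in> S \<Longrightarrow> \<xi> t \<in> topspace F" "\<And>t. t \<in> S \<Longrightarrow> \<xi>' t \<in> topspace F"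
    and a: "a \<in> S" "\<sigma> a = \<sigma>' a" and t: "t \<in> S"
  shows "\<sigma> t = \<sigma>' t" "\<xi> t = \<xi>' t"
proof -
  have d: "\<exists>d. \<sigma> u = \<sigma>' u + of_int d \<and> \<xi>' u = \<rho> d (\<xi> u)" if "u \<in> S" for u
    using covering_proj_eq_iff[OF \<xi>(1)[OF that] \<xi>(2)[OF that]] eq[OF that] by blast
  have "\<sigma> t - \<sigma>' t = \<sigma> a - \<sigma>' a"
  proof (rule continuous_integer_valued_constant[OF S _ _ t a(1)])
    show "continuous_on S (\<lambda>u. \<sigma> u - \<sigma>' u)" by (intro continuous_intros \<sigma>)
    show "(\<lambda>u. \<sigma> u - \<sigma>' u) ` S \<subseteq> \<int>" using d by fastforce
  qed
  then show *: "\<sigma> t = \<sigma>' t" using a(2) by simp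
  obtain d where "\<sigma> t = \<sigma>' t + of_int d" "\<xi>' t = \<rho> d (\<xi> t)" using d[OF t] by blast
  then show "\<xi> t = \<xi>' t" using * action_0[OF \<xi>(1)[OF t]] by simp
qed

end

section \<open>Loops in a mapping torus\<close>

context integer_action begin

text \<open>These are the paths in the fibre that close up in the mapping torus after \<open>d\<close> turns.\<close>

definition twisted_path :: "'a \<Rightarrow> int \<Rightarrow> (real \<Rightarrow> 'a) \<Rightarrow> bool" where
  "twisted_path x d \<alpha> \<longleftrightarrow> pathin F \<alpha> \<and> \<alpha> 0 = x \<and> \<alpha> 1 = \<rho> (- d) x"

definition spiral :: "int \<Rightarrow> (real \<Rightarrow> 'a) \<Rightarrow> real \<Rightarrow> ('a \<times> real) set" where
  "spiral d \<alpha> = (\<lambda>t. covering_proj (\<alpha> t, of_int d * t))"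

lemma pathin_covering_proj:
  assumes "pathin F \<alpha>" "continuous_on {0..1} \<sigma>"
  shows "pathin torus (\<lambda>t. covering_proj (\<alpha> t, \<sigma> t))"
proof -
  have "continuous_map (top_of_set {0..1}) cover (\<lambda>t. (\<alpha> t, \<sigma> t))"
    using assms by (simp add: continuous_map_paired pathin_def)
  from continuous_map_compose[OF this continuous_map_covering_proj]
  show ?thesis by (simp add: pathin_def comp_def)
qed

text \<open>Only the end heights matter up to homotopy, since the heights in between can be interpolated
  linearly without moving the point of the fibre.\<close>

lemma height_homotopy:
  assumes \<alpha>: "pathin F \<alpha>" and \<sigma>: "continuous_on {0..1} \<sigma>" "continuous_on {0..1} \<tau>"
    and ends: "\<sigma> 0 = \<tau> 0" "\<sigma> 1 = \<tau> 1"
  shows "path_homotopic torus (\<lambda>t. covering_proj (\<alpha> t, \<sigma> t)) (\<lambda>t. covering_proj (\<alpha> t, \<tau> t))"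
proof (rule path_homotopicI)
  let ?I = "top_of_set {0..1::real}"
  let ?h = "\<lambda>z. (\<alpha> (snd z), (1 - fst z) * \<sigma> (snd z) + fst z * \<tau> (snd z))"
  have "continuous_map (prod_topology ?I ?I) F (\<alpha> \<circ> snd)"
    using \<alpha> unfolding pathin_def by (rule continuous_map_compose[OF continuous_map_snd])
  moreover have "continuous_on ({0..1} \<times> {0..1}) (\<lambda>z. (1 - fst z) * \<sigma> (snd z) + fst z * \<tau> (snd z))"
    by (intro continuous_intros continuous_on_compose2[OF \<sigma>(1)] continuous_on_compose2[OF \<sigma>(2)]) auto
  ultimately have "continuous_map (prod_topology ?I ?I) cover ?h"
    by (simp add: continuous_map_paired prod_topology_subtopology_eu comp_def)
  from continuous_map_compose[OF this continuous_map_covering_proj]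
  show "continuous_map (prod_topology ?I ?I) torus (covering_proj \<circ> ?h)" .
qed (use ends in \<open>auto simp: algebra_simps\<close>)

lemma covering_proj_base:
  assumes "x \<in> topspace F"
  shows "covering_proj (\<rho> (- d) x, of_int d) = covering_proj (x, 0)"
  using covering_proj_shift[OF assms, of d 0] by simp

lemma spiral_loop:
  assumes "x \<in> topspace F" "twisted_path x d \<alpha>"
  shows "spiral d \<alpha> \<in> loops torus (covering_proj (x, 0))"
proof -
  have "pathin torus (spiral d \<alpha>)"
    unfolding spiral_def using assms
    by (intro pathin_covering_proj continuous_intros) (simp add: twisted_path_def)
  then show ?thesis
    using assms covering_proj_base[OF assms(1)] by (simp add: loops_def spiral_def twisted_path_def)
qed

lemma loop_homotopic_spiral:
  assumes x: "x \<in> topspace F" and p: "p \<in> loops torus (covering_proj (x, 0))"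
  obtains d \<alpha> where "twisted_path x d \<alpha>" "path_homotopic torus p (spiral d \<alpha>)"
proof -
  have p': "continuous_map (top_of_set {0..1}) torus p" "p 0 = covering_proj (x, 0)"
      "p 1 = covering_proj (x, 0)"
    using p by (auto simp: loops_def pathin_def)
  obtain \<xi> \<sigma> where \<xi>: "continuous_map (top_of_set {0..1}) F \<xi>" and \<sigma>: "continuous_on {0..1} \<sigma>"
    and lift: "\<And>t. t \<in> {0..1} \<Longrightarrow> p t = covering_proj (\<xi> t, \<sigma> t)" and base: "\<xi> 0 = x" "\<sigma> 0 = 0"
    by (rule lift_exists[OF p'(1) convex_imp_contractible[OF convex_closed_interval] _ x p'(2)])
       (use convex_real_interval in auto)
  have \<xi>F: "pathin F \<xi>" using \<xi> by (simp add: pathin_def)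
  have "covering_proj (\<xi> 1, \<sigma> 1) = covering_proj (x, 0)" using lift[of 1] p'(3) by simp
  then obtain d where d: "\<sigma> 1 = 0 + of_int d" "x = \<rho> d (\<xi> 1)"
    using covering_proj_eqE pathin_topspace[OF \<xi>F, of 1] x by (metis atLeastAtMost_iff order_refl zero_le_one)
  have "twisted_path x d \<xi>"
    using \<xi>F base d pathin_topspace[OF \<xi>F, of 1] by (simp add: twisted_path_def)
  moreover have "path_homotopic torus p (spiral d \<xi>)"
  proof -
    have "path_homotopic torus p (\<lambda>t. covering_proj (\<xi> t, \<sigma> t))"
      using p'(1) lift by (intro path_homotopic_cong) (auto simp: pathin_def)
    also have "path_homotopic torus \<dots> (spiral d \<xi>)"
      unfolding spiral_def using \<xi>F \<sigma> base d by (intro height_homotopy continuous_intros) auto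
    finally show ?thesis .
  qed
  ultimately show ?thesis using that by blast
qed

text \<open>For the direct implication the homotopy is lifted to \<open>F \<times> \<real>\<close>. Uniqueness of lifts identifies the lift on the
  four edges of the square: two edges carry the given paths and the other two are constant. Comparing
  heights at the corner \<open>(1, 1)\<close> gives \<open>d = e\<close>, and the fibre component of the lift is the required homotopy.\<close>

lemma spiral_homotopic_iff:
  assumes x: "x \<in> topspace F" and \<alpha>: "twisted_path x d \<alpha>" and \<beta>: "twisted_path x e \<beta>"
  shows "path_homotopic torus (spiral d \<alpha>) (spiral e \<beta>) \<longleftrightarrow> d = e \<and> path_homotopic F \<alpha> \<beta>"
proof
  let ?I = "{0..1::real}"
  have \<alpha>F: "pathin F \<alpha>" "\<alpha> 0 = x" "\<alpha> 1 = \<rho> (- d) x" and \<beta>F: "pathin F \<beta>" "\<beta> 0 = x" "\<beta> 1 = \<rho> (- e) x"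
    using \<alpha> \<beta> by (auto simp: twisted_path_def)
  assume "path_homotopic torus (spiral d \<alpha>) (spiral e \<beta>)"
  then obtain h where h: "continuous_map (prod_topology (top_of_set ?I) (top_of_set ?I)) torus h"
    "\<forall>t \<in> ?I. h (0, t) = spiral d \<alpha> t \<and> h (1, t) = spiral e \<beta> t \<and>
       h (t, 0) = spiral d \<alpha> 0 \<and> h (t, 1) = spiral d \<alpha> 1"
    unfolding path_homotopic_iff by auto
  have h1: "continuous_map (top_of_set (?I \<times> ?I)) torus h"
    using h(1) by (simp add: prod_topology_subtopology_eu)
  have sp0: "spiral d \<alpha> 0 = covering_proj (x, 0)" using \<alpha>F by (simp add: spiral_def)
  have contr: "contractible (?I \<times> ?I)" by (intro convex_imp_contractible convex_Times convex_real_interval)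
  have h0: "h (0, 0) = covering_proj (x, 0)" using h(2) sp0 by simp
  obtain \<xi> \<sigma> where \<xi>: "continuous_map (top_of_set (?I \<times> ?I)) F \<xi>" and \<sigma>: "continuous_on (?I \<times> ?I) \<sigma>"
    and lift: "\<And>z. z \<in> ?I \<times> ?I \<Longrightarrow> h z = covering_proj (\<xi> z, \<sigma> z)" and base: "\<xi> (0, 0) = x" "\<sigma> (0, 0) = 0"
    by (rule lift_exists[OF h1 contr _ x h0]) auto
  have \<xi>F: "\<xi> z \<in> topspace F" if "z \<in> ?I \<times> ?I" for z
    using \<xi> that by (auto simp: continuous_map_def Pi_iff)
  have conn: "connected ?I" by simp
  \<comment> \<open>The lift is known along each edge of the square.\<close>
  have left: "\<sigma> (0, t) = of_int d * t" "\<xi> (0, t) = \<alpha> t" if t: "t \<in> ?I" for t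
  proof -
    have c: "continuous_on ?I (\<lambda>t. \<sigma> (0, t))" "continuous_on ?I (\<lambda>t. of_int d * t)"
      by (intro continuous_intros continuous_on_compose2[OF \<sigma>], auto)+
    have eq: "covering_proj (\<xi> (0, t), \<sigma> (0, t)) = covering_proj (\<alpha> t, of_int d * t)" if "t \<in> ?I" for t
      using lift[of "(0, t)"] h(2) that by (simp add: spiral_def)
    show "\<sigma> (0, t) = of_int d * t" "\<xi> (0, t) = \<alpha> t"
      using lift_unique[OF conn c eq _ _ _ _ t, of 0] \<xi>F pathin_topspace[OF \<alpha>F(1)] base by auto
  qed
  have bottom: "\<sigma> (u, 0) = 0" "\<xi> (u, 0) = x" if u: "u \<in> ?I" for u
  proof -
    have c: "continuous_on ?I (\<lambda>u. \<sigma> (u, 0))" "continuous_on ?I (\<lambda>u. 0 :: real)"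
      by (intro continuous_intros continuous_on_compose2[OF \<sigma>], auto)+
    have eq: "covering_proj (\<xi> (u, 0), \<sigma> (u, 0)) = covering_proj (x, 0)" if "u \<in> ?I" for u
      using lift[of "(u, 0)"] h(2) that sp0 by simp
    show "\<sigma> (u, 0) = 0" "\<xi> (u, 0) = x"
      using lift_unique[OF conn c eq _ _ _ _ u, of 0] \<xi>F x base by auto
  qed
  have right: "\<sigma> (1, t) = of_int e * t" "\<xi> (1, t) = \<beta> t" if t: "t \<in> ?I" for t
  proof -
    have c: "continuous_on ?I (\<lambda>t. \<sigma> (1, t))" "continuous_on ?I (\<lambda>t. of_int e * t)"
      by (intro continuous_intros continuous_on_compose2[OF \<sigma>], auto)+
    have eq: "covering_proj (\<xi> (1, t), \<sigma> (1, t)) = covering_proj (\<beta> t, of_int e * t)" if "t \<in> ?I" for t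
      using lift[of "(1, t)"] h(2) that by (simp add: spiral_def)
    show "\<sigma> (1, t) = of_int e * t" "\<xi> (1, t) = \<beta> t"
      using lift_unique[OF conn c eq _ _ _ _ t, of 0] \<xi>F pathin_topspace[OF \<beta>F(1)] bottom[of 1] by auto
  qed
  have top: "\<sigma> (u, 1) = of_int d" "\<xi> (u, 1) = \<rho> (- d) x" if u: "u \<in> ?I" for u
  proof -
    have c: "continuous_on ?I (\<lambda>u. \<sigma> (u, 1))" "continuous_on ?I (\<lambda>u. of_int d :: real)"
      by (intro continuous_intros continuous_on_compose2[OF \<sigma>], auto)+
    have eq: "covering_proj (\<xi> (u, 1), \<sigma> (u, 1)) = covering_proj (\<rho> (- d) x, of_int d)" if "u \<in> ?I" for u
      using lift[of "(u, 1)"] h(2) that \<alpha>F by (simp add: spiral_def)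
    show "\<sigma> (u, 1) = of_int d" "\<xi> (u, 1) = \<rho> (- d) x"
      using lift_unique[OF conn c eq _ _ _ _ u, of 0] \<xi>F x left[of 1] by auto
  qed
  have "d = e" using right(1)[of 1] top(1)[of 1] by simp
  moreover have "path_homotopic F \<alpha> \<beta>"
  proof (rule path_homotopicI)
    show "continuous_map (prod_topology (top_of_set ?I) (top_of_set ?I)) F \<xi>"
      using \<xi> by (simp add: prod_topology_subtopology_eu)
  qed (use left right top bottom \<alpha>F in auto)
  ultimately show "d = e \<and> path_homotopic F \<alpha> \<beta>" by blast
next
  assume "d = e \<and> path_homotopic F \<alpha> \<beta>"
  then have de: "d = e" and "path_homotopic F \<alpha> \<beta>" by auto
  then obtain h where h: "continuous_map (prod_topology (top_of_set {0..1}) (top_of_set {0..1})) F h"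
    "\<forall>t \<in> {0..1::real}. h (0::real, t) = \<alpha> t \<and> h (1, t) = \<beta> t \<and> h (t, 0) = \<alpha> 0 \<and> h (t, 1) = \<alpha> 1"
    unfolding path_homotopic_iff by auto
  have "continuous_map (prod_topology (top_of_set {0..1}) (top_of_set {0..1})) euclideanreal
      (\<lambda>z::real \<times> real. of_int d * snd z)"
    unfolding prod_topology_subtopology_eu by (auto intro!: continuous_intros)
  with h(1) have "continuous_map (prod_topology (top_of_set {0..1}) (top_of_set {0..1})) cover
      (\<lambda>z. (h z, of_int d * snd z))" by (simp add: continuous_map_paired)
  from continuous_map_compose[OF this continuous_map_covering_proj]
  show "path_homotopic torus (spiral d \<alpha>) (spiral e \<beta>)"
    by (rule path_homotopicI) (use h(2) de in \<open>auto simp: spiral_def\<close>)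
qed

lemma twisted_path_concat:
  assumes x: "x \<in> topspace F" and \<alpha>: "twisted_path x d \<alpha>" and \<beta>: "twisted_path x e \<beta>"
  shows "twisted_path x (d + e) (path_concat \<alpha> (\<rho> (- d) \<circ> \<beta>))"
proof -
  have "pathin F (path_concat \<alpha> (\<rho> (- d) \<circ> \<beta>))"
    using \<alpha> \<beta> pathin_compose[OF _ continuous_action] by (intro pathin_concat) (auto simp: twisted_path_def)
  then show ?thesis
    using \<alpha> \<beta> action_add[OF x, of "- d" "- e"] by (simp add: twisted_path_def)
qed

text \<open>The second spiral starts at height \<open>d\<close> when it is lifted to continue the first one. There its fibre
  component is translated by \<open>\<rho> (- d)\<close>.\<close>

lemma spiral_concat:
  assumes x: "x \<in> topspace F" and \<alpha>: "twisted_path x d \<alpha>" and \<beta>: "twisted_path x e \<beta>"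
  shows "path_homotopic torus (path_concat (spiral d \<alpha>) (spiral e \<beta>))
           (spiral (d + e) (path_concat \<alpha> (\<rho> (- d) \<circ> \<beta>)))"
proof -
  let ?\<gamma> = "path_concat \<alpha> (\<rho> (- d) \<circ> \<beta>)"
  \<comment> \<open>The height rises to \<open>d\<close> on the first half and from there by \<open>e\<close> on the second half.\<close>
  let ?\<sigma> = "\<lambda>t::real. of_int d * min (2 * t) 1 + of_int e * max (2 * t - 1) 0"
  have "path_concat (spiral d \<alpha>) (spiral e \<beta>) t = covering_proj (?\<gamma> t, ?\<sigma> t)" if t: "t \<in> {0..1}" for t
  proof (cases "t \<le> 1/2")
    case False
    then have "\<beta> (2 * t - 1) \<in> topspace F"
      using \<beta> t by (intro pathin_topspace[of F]) (auto simp: twisted_path_def)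
    then show ?thesis
      using False covering_proj_shift[of "\<beta> (2 * t - 1)" d "of_int e * (2 * t - 1)"]
      by (simp add: path_concat_def spiral_def min_def max_def add.commute)
  qed (auto simp: path_concat_def spiral_def min_def max_def)
  moreover have "pathin torus (path_concat (spiral d \<alpha>) (spiral e \<beta>))"
    using loops_concat[OF spiral_loop[OF x \<alpha>] spiral_loop[OF x \<beta>]] by (simp add: loops_def)
  ultimately have "path_homotopic torus (path_concat (spiral d \<alpha>) (spiral e \<beta>))
      (\<lambda>t. covering_proj (?\<gamma> t, ?\<sigma> t))" by (intro path_homotopic_cong)
  also have "path_homotopic torus \<dots> (spiral (d + e) ?\<gamma>)"
    unfolding spiral_def using twisted_path_concat[OF x \<alpha> \<beta>]
    by (intro height_homotopy continuous_intros) (auto simp: twisted_path_def)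
  finally show ?thesis .
qed

end

text \<open>The group of pairs \<open>(d, [\<alpha>])\<close>, presented through a parametrisation \<open>\<Theta>\<close> of its elements; working with
  \<open>\<Theta>\<close> avoids a separate construction of that group.\<close>

locale twisted_path_group = integer_action F \<rho> + group G
  for F :: "'a topology" and \<rho> :: "int \<Rightarrow> 'a \<Rightarrow> 'a" and G :: "('g, 'm) monoid_scheme" (structure) +
  fixes x :: 'a and \<Theta> :: "int \<Rightarrow> (real \<Rightarrow> 'a) \<Rightarrow> 'g"
  assumes base: "x \<in> topspace F"
    and \<Theta>_closed: "twisted_path x d \<alpha> \<Longrightarrow> \<Theta> d \<alpha> \<in> carrier G"
    and \<Theta>_surj: "g \<in> carrier G \<Longrightarrow> \<exists>d \<alpha>. twisted_path x d \<alpha> \<and> g = \<Theta> d \<alpha>"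
    and \<Theta>_eq_iff: "\<lbrakk>twisted_path x d \<alpha>; twisted_path x e \<beta>\<rbrakk> \<Longrightarrow>
      \<Theta> d \<alpha> = \<Theta> e \<beta> \<longleftrightarrow> d = e \<and> path_homotopic F \<alpha> \<beta>"
    and \<Theta>_mult: "\<lbrakk>twisted_path x d \<alpha>; twisted_path x e \<beta>\<rbrakk> \<Longrightarrow>
      \<Theta> d \<alpha> \<otimes> \<Theta> e \<beta> = \<Theta> (d + e) (path_concat \<alpha> (\<rho> (- d) \<circ> \<beta>))"

text \<open>The parametrisation sends \<open>(d, \<alpha>)\<close> to the class of the spiral, moved to the base point \<open>y\<close> along a
  path \<open>c\<close>. The point \<open>x\<close> of the fibre can therefore be chosen independently of \<open>y\<close>.\<close>

theorem (in integer_action) fundamental_group_torus: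
  assumes F: "path_connected_space F" and x: "x \<in> topspace F" and y: "y \<in> topspace torus"
  shows "\<exists>\<Theta>. twisted_path_group F \<rho> (fundamental_group torus y) x \<Theta>"
proof -
  obtain x1 s where x1: "x1 \<in> topspace F" "y = covering_proj (x1, s)"
    using y unfolding topspace_torus_covering by auto
  obtain \<delta> where \<delta>: "pathin F \<delta>" "\<delta> 0 = x1" "\<delta> 1 = x"
    using F x x1(1) unfolding path_connected_space_def by blast
  \<comment> \<open>A path from \<open>y\<close> to the image of \<open>(x, 0)\<close>, along which the base point is moved.\<close>
  define c where "c = (\<lambda>t. covering_proj (\<delta> t, (1 - t) * s))"
  have c: "pathin torus c" unfolding c_def by (intro pathin_covering_proj \<delta> continuous_intros)
  have c0: "c 0 = y" and c1: "c 1 = covering_proj (x, 0)" using \<delta> x1 by (simp_all add: c_def)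
  define \<Theta> where "\<Theta> d \<alpha> = loop_class torus y (conjugate_path c (spiral d \<alpha>))" for d \<alpha>
  have sp: "spiral d \<alpha> \<in> loops torus (c 1)" if "twisted_path x d \<alpha>" for d \<alpha>
    unfolding c1 using spiral_loop[OF x that] .
  have csp: "conjugate_path c (spiral d \<alpha>) \<in> loops torus y" if "twisted_path x d \<alpha>" for d \<alpha>
    using conjugate_path_loop[OF c sp[OF that]] c0 by simp
  interpret group "fundamental_group torus y" by (rule group_fundamental_group[OF y])
  have "twisted_path_group F \<rho> (fundamental_group torus y) x \<Theta>"
  proof unfold_locales
    show "\<Theta> d \<alpha> \<in> carrier (fundamental_group torus y)" if "twisted_path x d \<alpha>" for d \<alpha>
      using csp[OF that] by (auto simp: \<Theta>_def carrier_fundamental_group)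
    show "\<exists>d \<alpha>. twisted_path x d \<alpha> \<and> g = \<Theta> d \<alpha>" if g: "g \<in> carrier (fundamental_group torus y)" for g
    proof -
      obtain p where p: "p \<in> loops torus y" "g = loop_class torus y p"
        using g by (auto simp: carrier_fundamental_group)
      let ?q = "conjugate_path (reverse_path c) p"
      have rc: "pathin torus (reverse_path c)" "p \<in> loops torus (reverse_path c 1)"
        using pathin_reverse[OF c] p(1) c0 by auto
      have "?q \<in> loops torus (covering_proj (x, 0))"
        using conjugate_path_loop[OF rc] c1 by simp
      then obtain d \<alpha> where \<alpha>: "twisted_path x d \<alpha>" "path_homotopic torus ?q (spiral d \<alpha>)"
        using loop_homotopic_spiral[OF x] by blast
      have q: "?q \<in> loops torus (c 1)" using conjugate_path_loop[OF rc] by simp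
      have "path_homotopic torus (conjugate_path c ?q) (conjugate_path c (spiral d \<alpha>))"
        by (rule conjugate_path_homotopic[OF c \<alpha>(2) q])
      moreover have "path_homotopic torus (conjugate_path c ?q) p"
        using conjugate_path_inverse[OF rc] by simp
      ultimately have "path_homotopic torus p (conjugate_path c (spiral d \<alpha>))"
        using path_homotopic_sym path_homotopic_trans by metis
      then have "g = \<Theta> d \<alpha>" using loop_class_eq_iff[OF p(1) csp[OF \<alpha>(1)]] p(2) by (simp add: \<Theta>_def)
      then show ?thesis using \<alpha>(1) by blast
    qed
    fix d e \<alpha> \<beta> assume \<alpha>: "twisted_path x d \<alpha>" and \<beta>: "twisted_path x e \<beta>"
    show "\<Theta> d \<alpha> = \<Theta> e \<beta> \<longleftrightarrow> d = e \<and> path_homotopic F \<alpha> \<beta>"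
      unfolding \<Theta>_def loop_class_eq_iff[OF csp[OF \<alpha>] csp[OF \<beta>]]
        conjugate_path_homotopic_iff[OF c sp[OF \<alpha>] sp[OF \<beta>]]
      by (rule spiral_homotopic_iff[OF x \<alpha> \<beta>])
    let ?\<gamma> = "path_concat \<alpha> (\<rho> (- d) \<circ> \<beta>)"
    have "path_homotopic torus (path_concat (conjugate_path c (spiral d \<alpha>)) (conjugate_path c (spiral e \<beta>)))
        (conjugate_path c (path_concat (spiral d \<alpha>) (spiral e \<beta>)))"
      by (rule conjugate_path_concat[OF c sp[OF \<alpha>] sp[OF \<beta>]])
    also have "path_homotopic torus \<dots> (conjugate_path c (spiral (d + e) ?\<gamma>))"
      by (rule conjugate_path_homotopic[OF c spiral_concat[OF x \<alpha> \<beta>] loops_concat[OF sp[OF \<alpha>] sp[OF \<beta>]]])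
    finally show "\<Theta> d \<alpha> \<otimes>\<^bsub>fundamental_group torus y\<^esub> \<Theta> e \<beta> = \<Theta> (d + e) ?\<gamma>"
      unfolding \<Theta>_def fundamental_group_mult[OF csp[OF \<alpha>] csp[OF \<beta>]]
      by (subst loop_class_eq_iff[OF loops_concat[OF csp[OF \<alpha>] csp[OF \<beta>]]
            csp[OF twisted_path_concat[OF x \<alpha> \<beta>]]])
  qed (rule x)
  then show ?thesis by blast
qed

section \<open>Homomorphisms that converge on profinite completions\<close>

lemma (in group) rcos_eq_iff:
  assumes "subgroup N G" "a \<in> carrier G" "b \<in> carrier G"
  shows "N #> a = N #> b \<longleftrightarrow> a \<in> N #> b"
  by (metis assms repr_independence repr_independenceD rcos_self)

text \<open>By Lagrange, since the order of the quotient is at most \<open>i\<close> and so divides \<open>i!\<close>.\<close>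

lemma (in group) pow_fact_mem_finite_index:
  assumes M: "M \<in> finite_index_normal G" and i: "card (carrier (G Mod M)) \<le> i"
    and w: "w \<in> carrier G"
  shows "w [^] (fact i :: nat) \<in> M"
proof -
  interpret N: normal M G using M by (simp add: finite_index_normal_def)
  interpret Q: group "G Mod M" by (rule N.factorgroup_is_group)
  have fin: "finite (carrier (G Mod M))" using M by (simp add: finite_index_normal_def)
  have "order (G Mod M) \<ge> 1" using fin Q.one_closed
    by (metis One_nat_def Suc_leI card_gt_0_iff empty_iff order_def)
  then have "order (G Mod M) dvd fact i" using i by (simp add: dvd_fact order_def)
  then obtain c where c: "fact i = order (G Mod M) * c" by (auto simp: dvd_def)
  have wc: "M #> w \<in> carrier (G Mod M)" using w by (auto simp: FactGroup_def RCOSETS_def)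
  have "(M #> w) [^]\<^bsub>G Mod M\<^esub> (fact i :: nat) = \<one>\<^bsub>G Mod M\<^esub>"
    using Q.pow_order_eq_1[OF wc] wc unfolding c by (metis Q.nat_pow_one Q.nat_pow_pow)
  moreover interpret h: group_hom G "G Mod M" "\<lambda>a. M #> a"
    using N.r_coset_hom_Mod by unfold_locales simp
  have "M #> (w [^] (fact i :: nat)) = (M #> w) [^]\<^bsub>G Mod M\<^esub> (fact i :: nat)"
    using h.hom_nat_pow[OF w] by simp
  ultimately have "M #> (w [^] (fact i :: nat)) = M" by (simp add: FactGroup_def)
  then show ?thesis using w N.subgroup_axioms coset_join1 by blast
qed

lemma (in normal) rcos_mult_mem:
  assumes "a \<in> carrier G" "w \<in> H"
  shows "H #> (a \<otimes> w) = H #> a"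
proof -
  have w: "w \<in> carrier G" using assms(2) by simp
  have "a \<otimes> w = (a \<otimes> w \<otimes> inv a) \<otimes> a" using assms(1) w by (simp add: m_assoc)
  moreover have "a \<otimes> w \<otimes> inv a \<in> H" using assms by (rule inv_op_closed2)
  ultimately have "a \<otimes> w \<in> H #> a" unfolding r_coset_def by blast
  then show ?thesis using assms(1) w by (simp add: rcos_eq_iff[OF subgroup_axioms])
qed

lemma profinite_completion_coset:
  assumes "group G" "s \<in> carrier (profinite_completion G)" "N \<in> finite_index_normal G"
  obtains g where "g \<in> carrier G" "s N = N #>\<^bsub>G\<^esub> g" "g \<in> s N"
proof -
  interpret group G by fact
  interpret N: normal N G using assms(3) by (simp add: finite_index_normal_def)
  have "s N \<in> rcosets\<^bsub>G\<^esub> N"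
    using assms(2,3) by (auto simp: profinite_completion_def FactGroup_def PiE_iff)
  then obtain g where "g \<in> carrier G" "s N = N #>\<^bsub>G\<^esub> g" by (auto simp: RCOSETS_def)
  then show ?thesis using that rcos_self N.subgroup_axioms by auto
qed

lemma profinite_completion_coset_eq:
  assumes "group G" "s \<in> carrier (profinite_completion G)" "N \<in> finite_index_normal G"
    and "g \<in> s N"
  shows "g \<in> carrier G" "s N = N #>\<^bsub>G\<^esub> g"
proof -
  interpret group G by fact
  interpret N: normal N G using assms(3) by (simp add: finite_index_normal_def)
  obtain a where a: "a \<in> carrier G" "s N = N #>\<^bsub>G\<^esub> a"
    using profinite_completion_coset assms by blast
  show "g \<in> carrier G" using a assms(4) r_coset_subset_G N.subset by blast
  then show "s N = N #>\<^bsub>G\<^esub> g" using a assms(4) rcos_eq_iff[OF N.subgroup_axioms] by blast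
qed

lemma (in group) set_mult_rcos_supgroup:
  assumes "subgroup N G" "subgroup N' G" "N \<subseteq> N'" "g \<in> carrier G"
  shows "N' <#> (N #> g) = N' #> g"
proof -
  have "N' <#> N = N'"
  proof
    show "N' <#> N \<subseteq> N'"
      using assms(3) subgroup.m_closed[OF assms(2)] by (auto simp: set_mult_def)
    show "N' \<subseteq> N' <#> N"
    proof
      fix a assume "a \<in> N'"
      moreover from this have "a = a \<otimes> \<one>" using subgroup.mem_carrier[OF assms(2)] by simp
      ultimately show "a \<in> N' <#> N"
        using subgroup.one_closed[OF assms(1)] unfolding set_mult_def by blast
    qed
  qed
  then show ?thesis using setmult_rcos_assoc[of N' N g] assms subgroup.subset by metis
qed

text \<open>The compatibility condition of the inverse limit, read on cosets as sets. Hence a representative at \<open>N\<close> serves for every larger \<open>N'\<close>.\<close>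

lemma profinite_completion_mono:
  assumes "group G" "s \<in> carrier (profinite_completion G)"
    and "N \<in> finite_index_normal G" "N' \<in> finite_index_normal G" "N \<subseteq> N'"
  shows "s N \<subseteq> s N'"
proof
  interpret group G by fact
  fix g assume g: "g \<in> s N"
  have sub: "subgroup N G" "subgroup N' G"
    using assms(3,4) by (auto simp: finite_index_normal_def normal_def)
  note g1 = profinite_completion_coset_eq[OF assms(1,2,3) g]
  have "s N' = N' <#>\<^bsub>G\<^esub> s N"
    using assms by (auto simp: profinite_completion_def)
  also have "\<dots> = N' #>\<^bsub>G\<^esub> g" unfolding g1(2) using set_mult_rcos_supgroup[OF sub assms(5) g1(1)] .
  finally show "g \<in> s N'" using rcos_self[OF g1(1) sub(2)] by simp
qed

lemma topspace_profinite_topology: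
  "topspace (profinite_topology K) = carrier (profinite_completion K)"
  by (auto simp: profinite_topology_def profinite_completion_def)

text \<open>Two consecutive homomorphisms differ by \<open>i!\<close>-th powers, which vanish in all quotients of order at
  most \<open>i\<close>. So modulo each normal subgroup of finite index the sequence is eventually constant, and
  it converges to a homomorphism into the profinite completion of \<open>H\<close>.\<close>

locale profinitely_Cauchy_homs = G: group G + H: group H
  for G :: "('a, 'c) monoid_scheme" and H :: "('b, 'd) monoid_scheme" +
  fixes j :: "nat \<Rightarrow> 'a \<Rightarrow> 'b"
  assumes hom: "j i \<in> hom G H"
    and Cauchy: "g \<in> carrier G \<Longrightarrow>
      \<exists>w \<in> carrier H. j (Suc i) g = j i g \<otimes>\<^bsub>H\<^esub> w [^]\<^bsub>H\<^esub> (fact i :: nat)"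
begin

lemma closed [simp]: "g \<in> carrier G \<Longrightarrow> j i g \<in> carrier H"
  using hom by (auto simp: hom_def)

lemma coset_stable:
  assumes M: "M \<in> finite_index_normal H" and i: "card (carrier (H Mod M)) \<le> i" "i \<le> i'"
    and g: "g \<in> carrier G"
  shows "M #>\<^bsub>H\<^esub> j i' g = M #>\<^bsub>H\<^esub> j i g"
  using i(2)
proof (induction rule: dec_induct)
  case (step n)
  interpret M: normal M H using M by (simp add: finite_index_normal_def)
  obtain w where w: "w \<in> carrier H" "j (Suc n) g = j n g \<otimes>\<^bsub>H\<^esub> w [^]\<^bsub>H\<^esub> (fact n :: nat)"
    using Cauchy[OF g] by (rule bexE)
  have wM: "w [^]\<^bsub>H\<^esub> (fact n :: nat) \<in> M"
    using H.pow_fact_mem_finite_index[OF M _ w(1)] i step by simp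
  have "M #>\<^bsub>H\<^esub> j (Suc n) g = M #>\<^bsub>H\<^esub> j n g"
    unfolding w(2) using M.rcos_mult_mem[OF closed[OF g] wM] .
  also note step.IH
  finally show ?case .
qed simp

text \<open>The kernel of the limit homomorphism modulo \<open>M\<close>; the order of the quotient is an index from which on the
  sequence is constant modulo \<open>M\<close>.\<close>

definition pullback :: "'b set \<Rightarrow> 'a set" where
  "pullback M = kernel G (H Mod M) (\<lambda>g. M #>\<^bsub>H\<^esub> j (card (carrier (H Mod M))) g)"

lemma group_hom_pullback:
  assumes M: "M \<in> finite_index_normal H"
  shows "group_hom G (H Mod M) (\<lambda>g. M #>\<^bsub>H\<^esub> j i g)"
proof -
  interpret M: normal M H using M by (simp add: finite_index_normal_def)
  have "(\<lambda>a. M #>\<^bsub>H\<^esub> a) \<circ> j i \<in> hom G (H Mod M)"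
    using hom_compose[OF hom M.r_coset_hom_Mod] .
  then show ?thesis
    using M.factorgroup_is_group G.is_group
    by (simp add: group_hom_def group_hom_axioms_def comp_def)
qed

lemma pullback_iff:
  assumes M: "M \<in> finite_index_normal H" and i: "card (carrier (H Mod M)) \<le> i"
  shows "g \<in> pullback M \<longleftrightarrow> g \<in> carrier G \<and> j i g \<in> M"
proof -
  interpret M: normal M H using M by (simp add: finite_index_normal_def)
  have one: "\<one>\<^bsub>H Mod M\<^esub> = M" by (simp add: FactGroup_def)
  show ?thesis
  proof (cases "g \<in> carrier G")
    case True
    have "g \<in> pullback M \<longleftrightarrow> M #>\<^bsub>H\<^esub> j i g = M"
      unfolding pullback_def kernel_def coset_stable[OF M order_refl i True] one
      using True by blast
    also have "\<dots> \<longleftrightarrow> j i g \<in> M"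
      using H.coset_join1[OF _ closed[OF True] M.subgroup_axioms] M.rcos_const by blast
    finally show ?thesis using True by blast
  qed (simp add: pullback_def kernel_def)
qed

lemma pullback_finite_index:
  assumes M: "M \<in> finite_index_normal H"
  shows "pullback M \<in> finite_index_normal G"
proof -
  interpret h: group_hom G "H Mod M" "\<lambda>g. M #>\<^bsub>H\<^esub> j (card (carrier (H Mod M))) g"
    by (rule group_hom_pullback[OF M])
  have "pullback M \<lhd> G" unfolding pullback_def by (rule h.normal_kernel)
  moreover have "finite (carrier (G Mod pullback M))"
    unfolding pullback_def
  proof (rule inj_on_finite[OF h.FactGroup_inj_on])
    show "(\<lambda>X. the_elem ((\<lambda>g. M #>\<^bsub>H\<^esub> j (card (carrier (H Mod M))) g) ` X)) `
        carrier (G Mod kernel G (H Mod M) (\<lambda>g. M #>\<^bsub>H\<^esub> j (card (carrier (H Mod M))) g))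
        \<subseteq> carrier (H Mod M)"
      using h.FactGroup_hom by (auto simp: hom_def)
  qed (use M in \<open>simp add: finite_index_normal_def\<close>)
  ultimately show ?thesis by (simp add: finite_index_normal_def)
qed

lemma pullback_mono:
  assumes "M \<in> finite_index_normal H" "M' \<in> finite_index_normal H" "M \<subseteq> M'"
  shows "pullback M \<subseteq> pullback M'"
proof
  let ?i = "max (card (carrier (H Mod M))) (card (carrier (H Mod M')))"
  fix g assume "g \<in> pullback M"
  then show "g \<in> pullback M'"
    using pullback_iff[OF assms(1) max.cobounded1] pullback_iff[OF assms(2) max.cobounded2] assms(3)
    by blast
qed

text \<open>The extension of the limit homomorphism to the completion of \<open>G\<close>. Its value does not depend on the
  representative of the coset nor on the index, by \<open>completion_map_rcos\<close>.\<close>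

definition completion_map :: "('a set \<Rightarrow> 'a set) \<Rightarrow> 'b set \<Rightarrow> 'b set" where
  "completion_map s = (\<lambda>M \<in> finite_index_normal H.
     M #>\<^bsub>H\<^esub> j (card (carrier (H Mod M))) (SOME g. g \<in> s (pullback M)))"

lemma completion_map_rcos:
  assumes M: "M \<in> finite_index_normal H" and i: "card (carrier (H Mod M)) \<le> i"
    and g: "g \<in> carrier G" "s (pullback M) = pullback M #>\<^bsub>G\<^esub> g"
  shows "completion_map s M = M #>\<^bsub>H\<^esub> j i g"
proof -
  interpret M: normal M H using M by (simp add: finite_index_normal_def)
  interpret N: normal "pullback M" G
    using pullback_finite_index[OF M] by (simp add: finite_index_normal_def)
  define g' where "g' = (SOME g. g \<in> s (pullback M))"
  have "g \<in> s (pullback M)" using G.rcos_self[OF g(1) N.subgroup_axioms] g(2) by simp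
  then have "g' \<in> s (pullback M)" unfolding g'_def by (rule someI)
  then obtain p where p: "p \<in> pullback M" "g' = p \<otimes>\<^bsub>G\<^esub> g" using g(2) by (auto simp: r_coset_def)
  have pG: "p \<in> carrier G" "j i p \<in> M" using p(1) pullback_iff[OF M i] by auto
  have g'G: "g' \<in> carrier G" using p g pG by simp
  have "completion_map s M = M #>\<^bsub>H\<^esub> j i g'"
    using coset_stable[OF M order_refl i g'G] M by (simp add: completion_map_def g'_def)
  also have "\<dots> = M #>\<^bsub>H\<^esub> (j i p \<otimes>\<^bsub>H\<^esub> j i g)"
    unfolding p(2) using hom_mult[OF hom pG(1) g(1)] by simp
  also have "\<dots> = (M #>\<^bsub>H\<^esub> j i p) #>\<^bsub>H\<^esub> j i g"
    using H.coset_mult_assoc[OF M.subset] pG(1) g(1) by simp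
  also have "M #>\<^bsub>H\<^esub> j i p = M" using M.rcos_const pG by simp
  finally show ?thesis .
qed

lemma completion_map_eq:
  assumes "s \<in> carrier (profinite_completion G)" "M \<in> finite_index_normal H"
    and "g \<in> s (pullback M)" "card (carrier (H Mod M)) \<le> i"
  shows "completion_map s M = M #>\<^bsub>H\<^esub> j i g"
  using completion_map_rcos[of M i g s] assms
    profinite_completion_coset_eq[OF G.is_group assms(1) pullback_finite_index[OF assms(2)] assms(3)]
  by simp

lemma completion_map_closed:
  assumes s: "s \<in> carrier (profinite_completion G)"
  shows "completion_map s \<in> carrier (profinite_completion H)"
proof -
  have "completion_map s M \<in> carrier (H Mod M)" if M: "M \<in> finite_index_normal H" for M
  proof -
    obtain g where g: "g \<in> carrier G" "s (pullback M) = pullback M #>\<^bsub>G\<^esub> g" "g \<in> s (pullback M)"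
      by (rule profinite_completion_coset[OF G.is_group s pullback_finite_index[OF M]])
    show ?thesis
      unfolding completion_map_rcos[of M _ g s, OF M order_refl g(1,2)]
      using closed[OF g(1)] by (auto simp: FactGroup_def RCOSETS_def)
  qed
  moreover have "M' <#>\<^bsub>H\<^esub> completion_map s M = completion_map s M'"
    if M: "M \<in> finite_index_normal H" and M': "M' \<in> finite_index_normal H" and sub: "M \<subseteq> M'"
    for M M'
  proof -
    let ?i = "max (card (carrier (H Mod M))) (card (carrier (H Mod M')))"
    obtain g where g: "g \<in> carrier G" "s (pullback M) = pullback M #>\<^bsub>G\<^esub> g" "g \<in> s (pullback M)"
      by (rule profinite_completion_coset[OF G.is_group s pullback_finite_index[OF M]])
    have g': "g \<in> s (pullback M')"
      using profinite_completion_mono[OF G.is_group s pullback_finite_index[OF M]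
          pullback_finite_index[OF M'] pullback_mono[OF M M' sub]] g(3) by (rule subsetD)
    have "completion_map s M = M #>\<^bsub>H\<^esub> j ?i g" "completion_map s M' = M' #>\<^bsub>H\<^esub> j ?i g"
      using completion_map_eq[OF s M g(3)] completion_map_eq[OF s M' g'] by auto
    then show ?thesis
      using H.set_mult_rcos_supgroup sub g(1) M M'
      by (simp add: finite_index_normal_def normal_def)
  qed
  ultimately show ?thesis
    by (auto simp: profinite_completion_def completion_map_def)
qed

lemma completion_map_hom:
  "completion_map \<in> hom (profinite_completion G) (profinite_completion H)"
proof (rule homI)
  fix s t assume s: "s \<in> carrier (profinite_completion G)" and t: "t \<in> carrier (profinite_completion G)"
  show "completion_map (s \<otimes>\<^bsub>profinite_completion G\<^esub> t) =
      completion_map s \<otimes>\<^bsub>profinite_completion H\<^esub> completion_map t"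
  proof
    fix M
    show "completion_map (s \<otimes>\<^bsub>profinite_completion G\<^esub> t) M =
      (completion_map s \<otimes>\<^bsub>profinite_completion H\<^esub> completion_map t) M"
    proof (cases "M \<in> finite_index_normal H")
      case M: True
      interpret M: normal M H using M by (simp add: finite_index_normal_def)
      interpret N: normal "pullback M" G
        using pullback_finite_index[OF M] by (simp add: finite_index_normal_def)
      note fin = pullback_finite_index[OF M]
      obtain a where a: "a \<in> carrier G" "s (pullback M) = pullback M #>\<^bsub>G\<^esub> a" "a \<in> s (pullback M)"
        by (rule profinite_completion_coset[OF G.is_group s fin])
      obtain b where b: "b \<in> carrier G" "t (pullback M) = pullback M #>\<^bsub>G\<^esub> b" "b \<in> t (pullback M)"
        by (rule profinite_completion_coset[OF G.is_group t fin])
      let ?m = "card (carrier (H Mod M))"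
      have "(s \<otimes>\<^bsub>profinite_completion G\<^esub> t) (pullback M) = pullback M #>\<^bsub>G\<^esub> (a \<otimes>\<^bsub>G\<^esub> b)"
        using fin N.rcos_sum a b by (simp add: profinite_completion_def)
      then have "completion_map (s \<otimes>\<^bsub>profinite_completion G\<^esub> t) M = M #>\<^bsub>H\<^esub> j ?m (a \<otimes>\<^bsub>G\<^esub> b)"
        using completion_map_rcos[OF M order_refl] a(1) b(1) by simp
      also have "\<dots> = (M #>\<^bsub>H\<^esub> j ?m a) <#>\<^bsub>H\<^esub> (M #>\<^bsub>H\<^esub> j ?m b)"
        using M.rcos_sum hom_mult[OF hom] a(1) b(1) by simp
      finally show ?thesis
        using completion_map_rcos[of M ?m a s, OF M order_refl a(1,2)]
          completion_map_rcos[of M ?m b t, OF M order_refl b(1,2)] M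
        by (simp add: profinite_completion_def)
    qed (simp add: completion_map_def profinite_completion_def)
  qed
qed (rule completion_map_closed)

text \<open>Each coordinate of the image depends on one coordinate of the argument, through a map of
  discrete spaces.\<close>

lemma continuous_map_completion_map:
  "continuous_map (profinite_topology G) (profinite_topology H) completion_map"
proof -
  have "continuous_map (profinite_topology G) (discrete_topology (carrier (H Mod M)))
      (\<lambda>s. completion_map s M)" if M: "M \<in> finite_index_normal H" for M
  proof -
    note fin = pullback_finite_index[OF M]
    let ?D = "discrete_topology (carrier (G Mod pullback M))"
    let ?f = "\<lambda>C. M #>\<^bsub>H\<^esub> j (card (carrier (H Mod M))) (SOME g. g \<in> C)"
    have "continuous_map (profinite_topology G) ?D (\<lambda>s. s (pullback M))"
      unfolding profinite_topology_def
      by (rule continuous_map_from_subtopology) (rule continuous_map_product_projection[OF fin])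
    moreover have "continuous_map ?D (discrete_topology (carrier (H Mod M))) ?f"
    proof -
      have "?f C \<in> carrier (H Mod M)" if "C \<in> carrier (G Mod pullback M)" for C
      proof -
        interpret N: normal "pullback M" G using fin by (simp add: finite_index_normal_def)
        from that obtain g where g: "g \<in> carrier G" "C = pullback M #>\<^bsub>G\<^esub> g"
          by (auto simp: FactGroup_def RCOSETS_def)
        then have "g \<in> C" using G.rcos_self N.subgroup_axioms by blast
        then have "(SOME g. g \<in> C) \<in> C" by (rule someI)
        moreover have "C \<subseteq> carrier G" using g G.r_coset_subset_G N.subset by blast
        ultimately have "(SOME g. g \<in> C) \<in> carrier G" by blast
        then show ?thesis using closed by (auto simp: FactGroup_def RCOSETS_def)
      qed
      then show ?thesis by (auto simp: continuous_map_def Pi_iff)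
    qed
    ultimately have "continuous_map (profinite_topology G) (discrete_topology (carrier (H Mod M)))
      (?f \<circ> (\<lambda>s. s (pullback M)))" by (rule continuous_map_compose)
    then show ?thesis using M by (simp add: completion_map_def comp_def)
  qed
  moreover have "completion_map ` topspace (profinite_topology G) \<subseteq> carrier (profinite_completion H)"
    using completion_map_closed by (auto simp: topspace_profinite_topology)
  ultimately show ?thesis
    unfolding profinite_topology_def[of H]
    by (auto simp: continuous_map_in_subtopology continuous_map_componentwise completion_map_def
        image_subset_iff)
qed

end

text \<open>The composites tend to the identity in the same sense, so the limits are inverse to each other.\<close>

locale profinitely_inverse_homs = J: profinitely_Cauchy_homs G H j + K: profinitely_Cauchy_homs H G k
  for G :: "('a, 'c) monoid_scheme" and H :: "('b, 'd) monoid_scheme"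
    and j :: "nat \<Rightarrow> 'a \<Rightarrow> 'b" and k :: "nat \<Rightarrow> 'b \<Rightarrow> 'a" +
  assumes kj: "g \<in> carrier G \<Longrightarrow>
      \<exists>w \<in> carrier G. k i (j i g) = g \<otimes>\<^bsub>G\<^esub> w [^]\<^bsub>G\<^esub> (fact i :: nat)"
    and jk: "h \<in> carrier H \<Longrightarrow>
      \<exists>w \<in> carrier H. j i (k i h) = h \<otimes>\<^bsub>H\<^esub> w [^]\<^bsub>H\<^esub> (fact i :: nat)"
begin

lemma kj_coset:
  assumes N: "N \<in> finite_index_normal G" and i: "card (carrier (G Mod N)) \<le> i"
    and g: "g \<in> carrier G"
  shows "N #>\<^bsub>G\<^esub> k i (j i g) = N #>\<^bsub>G\<^esub> g"
proof -
  interpret N: normal N G using N by (simp add: finite_index_normal_def)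
  obtain w where w: "w \<in> carrier G" "k i (j i g) = g \<otimes>\<^bsub>G\<^esub> w [^]\<^bsub>G\<^esub> (fact i :: nat)"
    using kj[OF g] by (rule bexE)
  have wN: "w [^]\<^bsub>G\<^esub> (fact i :: nat) \<in> N"
    using J.G.pow_fact_mem_finite_index[OF N i w(1)] .
  show ?thesis unfolding w(2) by (rule N.rcos_mult_mem[OF g wN])
qed

text \<open>The homomorphism \<open>k i\<close> is onto modulo \<open>N\<close> for large \<open>i\<close>, because \<open>j i g\<close> is a preimage of the
  class of \<open>g\<close>.\<close>

lemma finite_quotient:
  assumes N: "N \<in> finite_index_normal G"
  shows "\<exists>M \<in> finite_index_normal H. G Mod N \<cong> H Mod M"
proof -
  let ?m = "card (carrier (G Mod N))"
  interpret h: group_hom H "G Mod N" "\<lambda>h. N #>\<^bsub>G\<^esub> k ?m h"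
    by (rule K.group_hom_pullback[OF N])
  have "(\<lambda>h. N #>\<^bsub>G\<^esub> k ?m h) ` carrier H = carrier (G Mod N)"
  proof
    show "carrier (G Mod N) \<subseteq> (\<lambda>h. N #>\<^bsub>G\<^esub> k ?m h) ` carrier H"
    proof
      fix C assume "C \<in> carrier (G Mod N)"
      then obtain g where g: "g \<in> carrier G" "C = N #>\<^bsub>G\<^esub> g" by (auto simp: FactGroup_def RCOSETS_def)
      show "C \<in> (\<lambda>h. N #>\<^bsub>G\<^esub> k ?m h) ` carrier H"
        unfolding g(2) kj_coset[OF N order_refl g(1), symmetric]
        using J.closed[OF g(1)] by (rule imageI)
    qed
  qed (use h.hom_closed in blast)
  then have "H Mod K.pullback N \<cong> G Mod N" unfolding K.pullback_def by (rule h.FactGroup_iso)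
  moreover have "group (H Mod K.pullback N)"
    using K.pullback_finite_index[OF N] by (simp add: finite_index_normal_def normal.factorgroup_is_group)
  ultimately show ?thesis
    using K.pullback_finite_index[OF N] group.iso_sym by blast
qed

text \<open>At a fixed \<open>N\<close> only one large index \<open>i\<close> matters: if \<open>g\<close> represents \<open>s\<close> at the pullback of the pullback of
  \<open>N\<close>, a subgroup of \<open>N\<close>, then the composite has the value \<open>N k\<^sub>i(j\<^sub>i(g)) = N g\<close> there.\<close>

lemma completion_map_inverse:
  assumes s: "s \<in> carrier (profinite_completion G)"
  shows "K.completion_map (J.completion_map s) = s"
proof
  fix N
  note t = J.completion_map_closed[OF s]
  show "K.completion_map (J.completion_map s) N = s N"
  proof (cases "N \<in> finite_index_normal G")
    case N: True
    interpret N: normal N G using N by (simp add: finite_index_normal_def)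
    let ?M = "K.pullback N"
    note M = K.pullback_finite_index[OF N]
    let ?i = "max (card (carrier (G Mod N))) (card (carrier (H Mod ?M)))"
    obtain g where g: "g \<in> carrier G" "s (J.pullback ?M) = J.pullback ?M #>\<^bsub>G\<^esub> g" "g \<in> s (J.pullback ?M)"
      by (rule profinite_completion_coset[OF J.G.is_group s J.pullback_finite_index[OF M]])
    have "J.completion_map s ?M = ?M #>\<^bsub>H\<^esub> j ?i g"
      by (rule J.completion_map_rcos[of ?M ?i g s, OF M max.cobounded2 g(1,2)])
    moreover have "subgroup ?M H" using M by (simp add: finite_index_normal_def normal_def)
    ultimately have "K.completion_map (J.completion_map s) N = N #>\<^bsub>G\<^esub> k ?i (j ?i g)"
      using K.completion_map_rcos[of N ?i "j ?i g" "J.completion_map s", OF N max.cobounded1 J.closed[OF g(1)]]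
      by blast
    also have "\<dots> = N #>\<^bsub>G\<^esub> g" by (rule kj_coset[OF N max.cobounded1 g(1)])
    also have "J.pullback ?M \<subseteq> N"
    proof
      fix a assume "a \<in> J.pullback ?M"
      then have a: "a \<in> carrier G" "k ?i (j ?i a) \<in> N"
        using J.pullback_iff[OF M max.cobounded2] K.pullback_iff[OF N max.cobounded1] by blast+
      then show "a \<in> N"
        using kj_coset[OF N max.cobounded1 a(1)] N.rcos_const[OF J.G.is_group a(2)]
          J.G.rcos_self[OF a(1) N.subgroup_axioms] by blast
    qed
    then have "g \<in> s N"
      using profinite_completion_mono[OF J.G.is_group s J.pullback_finite_index[OF M] N] g(3) by blast
    then have "N #>\<^bsub>G\<^esub> g = s N"
      by (rule profinite_completion_coset_eq(2)[OF J.G.is_group s N, symmetric])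
    finally show ?thesis .
  qed (use s in \<open>auto simp: K.completion_map_def profinite_completion_def PiE_iff extensional_def\<close>)
qed

end

theorem (in profinitely_inverse_homs) profinitely_equivalent:
  "same_finite_quotients G H \<and> isomorphic_profinite_completions G H"
proof
  interpret sym: profinitely_inverse_homs H G k j
    by unfold_locales (use kj jk in auto)
  show "same_finite_quotients G H"
    unfolding same_finite_quotients_def using finite_quotient sym.finite_quotient by blast
  have "bij_betw J.completion_map (carrier (profinite_completion G)) (carrier (profinite_completion H))"
    by (rule bij_betw_byWitness[where f' = K.completion_map])
       (use completion_map_inverse sym.completion_map_inverse
          J.completion_map_closed K.completion_map_closed in auto)
  then have "J.completion_map \<in> iso (profinite_completion G) (profinite_completion H)"
    using J.completion_map_hom by (simp add: iso_def)
  moreover have "homeomorphic_maps (profinite_topology G) (profinite_topology H)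
      J.completion_map K.completion_map"
    unfolding homeomorphic_maps_def
    using J.continuous_map_completion_map K.continuous_map_completion_map
      completion_map_inverse sym.completion_map_inverse
    by (auto simp: topspace_profinite_topology)
  ultimately show "isomorphic_profinite_completions G H"
    unfolding isomorphic_profinite_completions_def homeomorphic_map_maps by blast
qed

section \<open>Mutually inverse profinite units\<close>

text \<open>Units modulo \<open>m\<close> lift to units modulo any multiple. The witness is the product of the primes that divide
  \<open>M\<close> but not \<open>a\<close>: a prime divisor of \<open>M\<close> then divides exactly one of the two summands.\<close>

lemma coprime_in_residue_class:
  fixes a m M :: int
  assumes "coprime a m" "M \<noteq> 0"
  obtains t where "coprime (a + t * m) M"
proof
  let ?P = "{p. prime p \<and> p dvd M \<and> \<not> p dvd a}"
  have "finite {p. p dvd M}" using assms(2) by (rule finite_divisors_int)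
  then have fin: "finite ?P" by (rule rev_finite_subset) blast
  show "coprime (a + \<Prod>?P * m) M"
  proof (rule ccontr)
    assume "\<not> coprime (a + \<Prod>?P * m) M"
    then obtain c where c: "c dvd a + \<Prod>?P * m" "c dvd M" "\<not> is_unit c" by (rule not_coprimeE)
    then obtain p where p: "prime p" "p dvd c" using prime_factor_int[of c] by auto
    have pM: "p dvd M" and pa: "p dvd a + \<Prod>?P * m" using c p dvd_trans by blast+
    show False
    proof (cases "p dvd a")
      case True
      then have "p dvd \<Prod>?P * m" using pa by (simp add: dvd_add_right_iff)
      moreover have "\<not> p dvd m" using assms(1) True p(1) coprime_common_divisor not_prime_unit by blast
      ultimately have "p dvd \<Prod>?P" using prime_dvd_mult_iff[OF p(1)] by blast
      then obtain q where "q \<in> ?P" "p dvd q" using prime_dvd_prod_iff[OF fin p(1)] by auto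
      then show False using True p(1) primes_dvd_imp_eq by blast
    next
      case False
      then have "p dvd \<Prod>?P" using fin p(1) pM by (intro dvd_prodI) auto
      then show False using False pa by (simp add: dvd_add_left_iff)
    qed
  qed
qed

lemma coprime_inverse_mod:
  fixes a m :: int
  assumes "coprime a m"
  obtains b where "m dvd a * b - 1"
proof -
  obtain u v where "u * a + v * m = 1" using bezout_int[of a m] assms by auto
  then have "a * u - 1 = m * (- v)" by (simp add: algebra_simps)
  then show ?thesis using that by (metis dvd_triv_left)
qed

lemma coprime_if_dvd_mult_minus_1:
  fixes a b m :: int
  assumes "m dvd a * b - 1"
  shows "coprime a m"
proof (rule coprimeI)
  fix c assume c: "c dvd a" "c dvd m"
  then have "c dvd a * b" "c dvd a * b - 1" using assms dvd_trans by auto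
  then have "c dvd a * b - (a * b - 1)" by (rule dvd_diff)
  then show "is_unit c" by simp
qed

text \<open>The sequence \<open>A\<close> approximates a unit of the profinite integers that reduces to \<open>a\<close> modulo \<open>n\<close>, and
  \<open>B\<close> its inverse. Each \<open>A\<close> is corrected to stay coprime to the next factorial; the congruences
  for \<open>B\<close> follow from those for \<open>A\<close> because inverses are unique.\<close>

lemma profinite_unit_approximation:
  fixes a b :: int and n :: nat
  assumes ab: "int n dvd a * b - 1" and n: "n > 0"
  obtains A B :: "nat \<Rightarrow> int" where
    "\<And>i. int n dvd A i - a" "\<And>i. int n dvd B i - b"
    "\<And>i. int n * fact i dvd A i * B i - 1"
    "\<And>i. int n * fact i dvd A (Suc i) - A i" "\<And>i. int n * fact i dvd B (Suc i) - B i"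
proof -
  let ?m = "\<lambda>i::nat. int n * fact i"
  have mono: "?m i dvd ?m (Suc i)" for i by simp
  have "\<exists>A :: nat \<Rightarrow> int. \<forall>i. (coprime (A i) (?m i) \<and> int n dvd A i - a) \<and> ?m i dvd A (Suc i) - A i"
  proof (rule dependent_nat_choice[where P = "\<lambda>i x. coprime x (?m i) \<and> int n dvd x - a"
        and Q = "\<lambda>i x y. ?m i dvd y - x"])
    show "\<exists>x. coprime x (?m 0) \<and> int n dvd x - a"
      using coprime_if_dvd_mult_minus_1[OF ab] by (intro exI[of _ a]) simp
    fix x i assume x: "coprime x (?m i) \<and> int n dvd x - a"
    then obtain t where t: "coprime (x + t * ?m i) (?m (Suc i))"
      using coprime_in_residue_class[of x "?m i" "?m (Suc i)"] n by auto
    have "int n dvd (x - a) + t * ?m i" using x by (intro dvd_add) auto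
    then have "int n dvd x + t * ?m i - a" by (simp add: algebra_simps)
    then show "\<exists>y. (coprime y (?m (Suc i)) \<and> int n dvd y - a) \<and> ?m i dvd y - x"
      using t by (intro exI[of _ "x + t * ?m i"]) auto
  qed
  then obtain A :: "nat \<Rightarrow> int" where A: "\<And>i. coprime (A i) (?m i)" "\<And>i. int n dvd A i - a"
    "\<And>i. ?m i dvd A (Suc i) - A i" by blast
  have "\<forall>i. \<exists>y. ?m i dvd A i * y - 1" using coprime_inverse_mod[OF A(1)] by metis
  then obtain B where B: "\<And>i. ?m i dvd A i * B i - 1" by metis
  have "int n dvd B i - b" for i
  proof -
    have "int n dvd A i * B i - 1" using B[of i] dvd_mult_left by blast
    then have "int n dvd (A i * B i - 1) - (A i - a) * B i - (a * b - 1)"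
      by (rule dvd_diff[OF dvd_diff[OF _ dvd_mult2[OF A(2)]] ab])
    \<comment> \<open>Both \<open>B i\<close> and \<open>b\<close> invert \<open>a\<close> modulo \<open>n\<close>.\<close>
    then have "int n dvd a * (B i - b)" by (simp add: algebra_simps)
    then show ?thesis
      using coprime_if_dvd_mult_minus_1[OF ab] by (simp add: coprime_dvd_mult_right_iff coprime_commute)
  qed
  moreover have "?m i dvd B (Suc i) - B i" for i
  proof -
    have "?m i dvd A (Suc i) * B (Suc i) - 1" using B[of "Suc i"] mono dvd_trans by blast
    then have "?m i dvd (A (Suc i) * B (Suc i) - 1) - (A (Suc i) - A i) * B (Suc i) - (A i * B i - 1)"
      by (rule dvd_diff[OF dvd_diff[OF _ dvd_mult2[OF A(3)]] B])
    then have "?m i dvd A i * (B (Suc i) - B i)" by (simp add: algebra_simps)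
    moreover have "coprime (?m i) (A i)" using A(1)[of i] by (simp only: coprime_commute)
    ultimately show ?thesis using coprime_dvd_mult_right_iff by blast
  qed
  ultimately show ?thesis using that A B by blast
qed

section \<open>Rescaling the number of turns\<close>

text \<open>When \<open>\<rho>\<close> has period \<open>n\<close>, the constant path closes up after any multiple of \<open>n\<close> turns. Multiplying by the resulting
  element changes the number of turns and keeps the path.\<close>

locale periodic_twisted_path_group = twisted_path_group F \<rho> G x \<Theta>
  for F :: "'a topology" and \<rho> and G :: "('g, 'm) monoid_scheme" (structure) and x \<Theta> +
  fixes n :: nat
  assumes period: "\<lbrakk>z \<in> topspace F; int n dvd c\<rbrakk> \<Longrightarrow> \<rho> c z = z"
begin

lemma action_cong:
  assumes "int n dvd c - d" "z \<in> topspace F"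
  shows "\<rho> c z = \<rho> d z"
  using action_add[OF assms(2), of "c - d" d] period[OF _ assms(1)] assms(2) by simp

lemma twisted_const: "int n dvd d \<Longrightarrow> twisted_path x d (\<lambda>_. x)"
  using base period[OF base, of "- d"] by (simp add: twisted_path_def pathin_def)

lemma \<Theta>_shift:
  assumes \<alpha>: "twisted_path x d \<alpha>" and m: "int n dvd m"
  shows "\<Theta> d \<alpha> \<otimes> \<Theta> m (\<lambda>_. x) = \<Theta> (d + m) \<alpha>"
proof -
  let ?\<gamma> = "path_concat \<alpha> (\<rho> (- d) \<circ> (\<lambda>_. x))"
  have "\<rho> (- (d + m)) x = \<rho> (- d) x" using base m by (intro action_cong) auto
  then have "twisted_path x (d + m) \<alpha>" using \<alpha> by (simp add: twisted_path_def)
  moreover have "path_homotopic F ?\<gamma> \<alpha>"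
    using path_concat_const_right[of F \<alpha> "\<rho> (- d) x"] \<alpha> by (simp add: twisted_path_def comp_def)
  ultimately have "\<Theta> (d + m) ?\<gamma> = \<Theta> (d + m) \<alpha>"
    using \<Theta>_eq_iff twisted_path_concat[OF base \<alpha> twisted_const[OF m]] by blast
  then show ?thesis using \<Theta>_mult[OF \<alpha> twisted_const[OF m]] by simp
qed

lemma \<Theta>_const_0: "\<Theta> 0 (\<lambda>_. x) = \<one>"
proof -
  have "\<Theta> 0 (\<lambda>_. x) \<otimes> \<Theta> 0 (\<lambda>_. x) = \<Theta> 0 (\<lambda>_. x)"
    using \<Theta>_shift[OF twisted_const, of 0 0] by simp
  then show ?thesis using \<Theta>_closed[OF twisted_const, of 0] by (simp add: l_cancel_one)
qed

lemma \<Theta>_const_pow: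
  assumes m: "int n dvd m"
  shows "\<Theta> m (\<lambda>_. x) [^] (k :: nat) = \<Theta> (int k * m) (\<lambda>_. x)"
proof (induction k)
  case (Suc k)
  then show ?case
    using \<Theta>_shift[OF twisted_const m, of "int k * m"] m by (simp add: algebra_simps)
qed (simp add: \<Theta>_const_0)

text \<open>Turns that differ by a multiple of \<open>n i!\<close> give elements that differ by an \<open>i!\<close>-th power.\<close>

lemma \<Theta>_shift_fact:
  assumes \<alpha>: "twisted_path x d \<alpha>" and e: "int n * fact i dvd e - d"
  shows "\<exists>w \<in> carrier G. \<Theta> e \<alpha> = \<Theta> d \<alpha> \<otimes> w [^] (fact i :: nat)"
proof -
  obtain t where t: "e - d = int n * fact i * t" using e by (auto simp: dvd_def)
  let ?m = "int n * t"
  have "\<Theta> ?m (\<lambda>_. x) [^] (fact i :: nat) = \<Theta> (e - d) (\<lambda>_. x)"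
    using \<Theta>_const_pow[of ?m "fact i"] t by (simp add: algebra_simps)
  moreover have "int n dvd e - d" using e dvd_mult_left by blast
  then have "\<Theta> d \<alpha> \<otimes> \<Theta> (e - d) (\<lambda>_. x) = \<Theta> e \<alpha>" using \<Theta>_shift[OF \<alpha>] by simp
  moreover have "\<Theta> ?m (\<lambda>_. x) \<in> carrier G" by (intro \<Theta>_closed twisted_const) simp
  ultimately show ?thesis by metis
qed

end

text \<open>The condition on \<open>\<rho>'\<close> says that a path closing up after \<open>d\<close> turns in the first group closes up after
  \<open>A i * d\<close> turns in the second.\<close>

locale rescaled_twisted_path_groups =
  P: periodic_twisted_path_group F \<rho> G x \<Theta> n + Q: periodic_twisted_path_group F \<rho>' H x \<Theta>' n
  for F :: "'a topology" and \<rho> and G :: "('g, 'm) monoid_scheme" and x \<Theta>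
    and n and \<rho>' and H :: "('h, 'k) monoid_scheme" and \<Theta>' +
  fixes A :: "nat \<Rightarrow> int"
  assumes rescale: "z \<in> topspace F \<Longrightarrow> \<rho>' (A i * d) z = \<rho> d z"
    and A_step: "int n * fact i dvd A (Suc i) - A i"
begin

text \<open>The map \<open>(d, \<alpha>) \<mapsto> (A i * d, \<alpha>)\<close>.\<close>

definition rescale_hom :: "nat \<Rightarrow> 'g \<Rightarrow> 'h" where
  "rescale_hom i g = (SOME h. \<exists>d \<alpha>. P.twisted_path x d \<alpha> \<and> g = \<Theta> d \<alpha> \<and> h = \<Theta>' (A i * d) \<alpha>)"

lemma twisted_rescale: "P.twisted_path x d \<alpha> \<Longrightarrow> Q.twisted_path x (A i * d) \<alpha>"
  using rescale[OF P.base, of i "- d"] by (simp add: P.twisted_path_def Q.twisted_path_def)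

lemma rescale_hom_\<Theta>:
  assumes \<alpha>: "P.twisted_path x d \<alpha>"
  shows "rescale_hom i (\<Theta> d \<alpha>) = \<Theta>' (A i * d) \<alpha>"
  unfolding rescale_hom_def
proof (rule some_equality)
  show "\<exists>e \<beta>. P.twisted_path x e \<beta> \<and> \<Theta> d \<alpha> = \<Theta> e \<beta> \<and> \<Theta>' (A i * d) \<alpha> = \<Theta>' (A i * e) \<beta>"
    using \<alpha> by blast
  fix h assume "\<exists>e \<beta>. P.twisted_path x e \<beta> \<and> \<Theta> d \<alpha> = \<Theta> e \<beta> \<and> h = \<Theta>' (A i * e) \<beta>"
  then obtain e \<beta> where \<beta>: "P.twisted_path x e \<beta>" "\<Theta> d \<alpha> = \<Theta> e \<beta>" "h = \<Theta>' (A i * e) \<beta>" by blast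
  then have "d = e" "path_homotopic F \<alpha> \<beta>" using P.\<Theta>_eq_iff[OF \<alpha> \<beta>(1)] by auto
  then show "h = \<Theta>' (A i * d) \<alpha>"
    using \<beta>(3) Q.\<Theta>_eq_iff[OF twisted_rescale[OF \<alpha>, of i] twisted_rescale[OF \<beta>(1), of i]] by simp
qed

sublocale profinitely_Cauchy_homs G H rescale_hom
proof
  fix i
  show "rescale_hom i \<in> hom G H"
  proof (rule homI)
    fix g assume "g \<in> carrier G"
    then obtain d \<alpha> where \<alpha>: "P.twisted_path x d \<alpha>" and g: "g = \<Theta> d \<alpha>" using P.\<Theta>_surj by blast
    show "rescale_hom i g \<in> carrier H"
      unfolding g rescale_hom_\<Theta>[OF \<alpha>] by (rule Q.\<Theta>_closed[OF twisted_rescale[OF \<alpha>]])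
    fix h assume "h \<in> carrier G"
    then obtain e \<beta> where \<beta>: "P.twisted_path x e \<beta>" and h: "h = \<Theta> e \<beta>" using P.\<Theta>_surj by blast
    let ?\<gamma> = "path_concat \<alpha> (\<rho> (- d) \<circ> \<beta>)" and ?\<delta> = "path_concat \<alpha> (\<rho>' (- (A i * d)) \<circ> \<beta>)"
    have \<gamma>: "P.twisted_path x (d + e) ?\<gamma>" by (rule P.twisted_path_concat[OF P.base \<alpha> \<beta>])
    have \<delta>: "Q.twisted_path x (A i * d + A i * e) ?\<delta>"
      by (rule Q.twisted_path_concat[OF P.base twisted_rescale[OF \<alpha>] twisted_rescale[OF \<beta>]])
    have "\<rho> (- d) z = \<rho>' (- (A i * d)) z" if "z \<in> topspace F" for z
      using rescale[OF that, of i "- d"] by simp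
    then have "?\<gamma> t = ?\<delta> t" if "t \<in> {0..1}" for t
      using that \<beta> pathin_topspace[of F \<beta> "2 * t - 1"] by (simp add: path_concat_def P.twisted_path_def)
    moreover have "pathin F ?\<gamma>" using \<gamma> by (simp add: P.twisted_path_def)
    ultimately have "path_homotopic F ?\<gamma> ?\<delta>" by (intro path_homotopic_cong)
    then have "\<Theta>' (A i * (d + e)) ?\<gamma> = \<Theta>' (A i * d + A i * e) ?\<delta>"
      using Q.\<Theta>_eq_iff[OF twisted_rescale[OF \<gamma>] \<delta>] by (simp add: distrib_left)
    then show "rescale_hom i (g \<otimes>\<^bsub>G\<^esub> h) = rescale_hom i g \<otimes>\<^bsub>H\<^esub> rescale_hom i h"
      unfolding g h P.\<Theta>_mult[OF \<alpha> \<beta>] rescale_hom_\<Theta>[OF \<alpha>] rescale_hom_\<Theta>[OF \<beta>] rescale_hom_\<Theta>[OF \<gamma>]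
        Q.\<Theta>_mult[OF twisted_rescale[OF \<alpha>] twisted_rescale[OF \<beta>]] .
  qed
  fix g assume "g \<in> carrier G"
  then obtain d \<alpha> where \<alpha>: "P.twisted_path x d \<alpha>" and g: "g = \<Theta> d \<alpha>" using P.\<Theta>_surj by blast
  have "int n * fact i dvd A (Suc i) * d - A i * d"
    using A_step[of i] by (simp add: left_diff_distrib[symmetric])
  then show "\<exists>w \<in> carrier H. rescale_hom (Suc i) g = rescale_hom i g \<otimes>\<^bsub>H\<^esub> w [^]\<^bsub>H\<^esub> (fact i :: nat)"
    unfolding g rescale_hom_\<Theta>[OF \<alpha>] by (rule Q.\<Theta>_shift_fact[OF twisted_rescale[OF \<alpha>]])
qed

end

lemma rescale_hom_composite:
  assumes "rescaled_twisted_path_groups F \<rho> G x \<Theta> n \<rho>' H \<Theta>' A"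
    and "rescaled_twisted_path_groups F \<rho>' H x \<Theta>' n \<rho> G \<Theta> B"
    and AB: "int n * fact i dvd A i * B i - 1" and g: "g \<in> carrier G"
  shows "\<exists>w \<in> carrier G. rescaled_twisted_path_groups.rescale_hom F \<rho>' x \<Theta>' \<Theta> B i
      (rescaled_twisted_path_groups.rescale_hom F \<rho> x \<Theta> \<Theta>' A i g) = g \<otimes>\<^bsub>G\<^esub> w [^]\<^bsub>G\<^esub> (fact i :: nat)"
proof -
  interpret A: rescaled_twisted_path_groups F \<rho> G x \<Theta> n \<rho>' H \<Theta>' A by fact
  interpret B: rescaled_twisted_path_groups F \<rho>' H x \<Theta>' n \<rho> G \<Theta> B by fact
  obtain d \<alpha> where \<alpha>: "A.P.twisted_path x d \<alpha>" and g: "g = \<Theta> d \<alpha>" using A.P.\<Theta>_surj g by blast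
  have "B i * (A i * d) - d = (A i * B i - 1) * d" by (simp add: algebra_simps)
  then have "int n * fact i dvd B i * (A i * d) - d" using AB by simp
  then show ?thesis
    unfolding g A.rescale_hom_\<Theta>[OF \<alpha>] B.rescale_hom_\<Theta>[OF A.twisted_rescale[OF \<alpha>]]
    by (rule A.P.\<Theta>_shift_fact[OF \<alpha>])
qed

section \<open>Surfaces and iterates of a homeomorphism\<close>

text \<open>Charts carry over the local path-connectedness of open subsets of the plane; with it a connected surface is
  path-connected.\<close>

lemma surface_locally_path_connected:
  assumes "surface X"
  shows "locally_path_connected_space X"
  unfolding locally_path_connected_space
proof (intro allI impI)
  fix W x assume W: "openin X W \<and> x \<in> W"
  then obtain U V where U: "openin X U" "x \<in> U" and V: "open (V :: (real^2) set)"
    and hom: "subtopology X U homeomorphic_space top_of_set V"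
    using assms openin_subset unfolding surface_def by blast
  have "locally_path_connected_space (top_of_set V)"
    unfolding locally_path_connected_space
  proof (intro allI impI)
    fix S y assume S: "openin (top_of_set V) S \<and> y \<in> S"
    then have "open S" "S \<subseteq> V" using V by (auto simp: openin_open_eq)
    then obtain e where e: "e > 0" "ball y e \<subseteq> S" using S open_contains_ball by blast
    then have "openin (top_of_set V) (ball y e)" "path_connectedin (top_of_set V) (ball y e)" "y \<in> ball y e"
      using V \<open>S \<subseteq> V\<close> by (auto simp: openin_open_eq path_connectedin_subtopology intro: convex_imp_path_connected)
    then show "\<exists>U. openin (top_of_set V) U \<and> path_connectedin (top_of_set V) U \<and> y \<in> U \<and> U \<subseteq> S"
      using e(2) by blast
  qed
  then have "locally_path_connected_space (subtopology X U)"
    using homeomorphic_locally_path_connected_space[OF hom] by blast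
  moreover have "openin (subtopology X U) (W \<inter> U)" "x \<in> W \<inter> U" using W U by (auto simp: openin_subtopology)
  ultimately obtain T where T: "openin (subtopology X U) T" "path_connectedin (subtopology X U) T"
      "x \<in> T" "T \<subseteq> W \<inter> U"
    unfolding locally_path_connected_space by meson
  then show "\<exists>T. openin X T \<and> path_connectedin X T \<and> x \<in> T \<and> T \<subseteq> W"
    using openin_trans_full[OF T(1) U(1)] by (auto simp: path_connectedin_subtopology)
qed

text \<open>The law of exponents follows by induction from the single rule that raising the exponent by one
  applies \<open>f\<close>, which holds across zero because \<open>f\<close> and its inverse cancel.\<close>

lemma integer_action_map_int_power:
  assumes f: "homeomorphic_map X X f"
  shows "integer_action X (map_int_power X f)"
proof -
  let ?S = "topspace X" and ?\<rho> = "map_int_power X f"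
  obtain g where g: "homeomorphic_maps X X f g" using f homeomorphic_map_maps by blast
  have cf: "continuous_map X X f" using g by (simp add: homeomorphic_maps_def)
  have fS: "f z \<in> ?S" if "z \<in> ?S" for z using cf that by (auto simp: continuous_map_def Pi_iff)
  have inj: "inj_on f ?S" using f by (simp add: homeomorphic_eq_everything_map)
  define h where "h = inv_into ?S f"
  have hg: "h z = g z" if "z \<in> ?S" for z
  proof -
    have "g z \<in> ?S" "f (g z) = z" using g that by (auto simp: homeomorphic_maps_def continuous_map_def Pi_iff)
    then show ?thesis unfolding h_def using inv_into_f_eq[OF inj] by blast
  qed
  have "continuous_map X X g" using g by (simp add: homeomorphic_maps_def)
  then have ch: "continuous_map X X h" using hg by (metis continuous_map_eq)
  have hS: "h z \<in> ?S" if "z \<in> ?S" for z using ch that by (auto simp: continuous_map_def Pi_iff)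
  have fh: "f (h z) = z" if "z \<in> ?S" for z using hg[OF that] g that by (simp add: homeomorphic_maps_def)
  have pow: "continuous_map X X (u ^^ m)" if "continuous_map X X u" for u and m :: nat
  proof (induction m)
    case (Suc m)
    show ?case unfolding funpow.simps by (rule continuous_map_compose[OF Suc that])
  qed (simp add: continuous_map_id[unfolded id_def] id_def)
  have cont: "continuous_map X X (?\<rho> d)" for d
    using pow[OF cf] pow[OF ch] by (simp add: map_int_power_def h_def)
  have closed: "?\<rho> d z \<in> ?S" if "z \<in> ?S" for d z
    using cont[of d] that by (auto simp: continuous_map_def Pi_iff)
  have step: "?\<rho> (d + 1) z = f (?\<rho> d z)" if z: "z \<in> ?S" for d z
  proof (cases "0 \<le> d")
    case True
    then have "nat (d + 1) = Suc (nat d)" by simp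
    then show ?thesis using True by (simp add: map_int_power_def)
  next
    case False
    define m where "m = nat (- d - 1)"
    have m: "nat (- d) = Suc m" "nat (- (d + 1)) = m" using False by (auto simp: m_def)
    have "(h ^^ m) z \<in> ?S" using pow[OF ch, of m] z by (auto simp: continuous_map_def Pi_iff)
    then have "f (?\<rho> d z) = (h ^^ m) z" using False m(1) fh by (simp add: map_int_power_def h_def)
    moreover have "?\<rho> (d + 1) z = (h ^^ m) z"
      using False m(2) by (cases "d = -1") (auto simp: map_int_power_def h_def)
    ultimately show ?thesis by simp
  qed
  show ?thesis
  proof
    show "continuous_map X X (?\<rho> d)" for d by (rule cont)
    show z0: "?\<rho> 0 z = z" for z by (simp add: map_int_power_def)
    fix z c d assume z: "z \<in> ?S"
    show "?\<rho> (c + d) z = ?\<rho> c (?\<rho> d z)"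
    proof (induction c rule: int_induct[where k = 0])
      case base
      show ?case using z0 by simp
    next
      case (step1 i)
      have "?\<rho> (i + 1 + d) z = f (?\<rho> (i + d) z)" using step[OF z, of "i + d"] by (simp add: add_ac)
      then show ?case using step1 step[OF closed[OF z], of i] by simp
    next
      case (step2 i)
      have "f (?\<rho> (i - 1 + d) z) = ?\<rho> (i + d) z" using step[OF z, of "i - 1 + d"] by (simp add: algebra_simps)
      also have "\<dots> = f (?\<rho> (i - 1) (?\<rho> d z))" using step2 step[OF closed[OF z], of "i - 1"] by simp
      finally show ?case using inj closed closed[OF closed] z by (auto dest: inj_onD)
    qed
  qed
qed

lemma (in integer_action) action_multiples:
  assumes "\<And>z. z \<in> topspace F \<Longrightarrow> \<rho> n z = z" "n dvd c" "z \<in> topspace F"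
  shows "\<rho> c z = z"
proof -
  obtain t where "c = n * t" using assms(2) by (auto simp: dvd_def)
  moreover have "\<rho> (n * t) z = z"
  proof (induction t rule: int_induct[where k = 0])
    case (step1 i)
    then show ?case using action_add[OF assms(3), of n "n * i"] assms(1)[OF assms(3)] by (simp add: algebra_simps)
  next
    case (step2 i)
    have "\<rho> (n * i) z = \<rho> n (\<rho> (n * (i - 1)) z)"
      using action_add[OF assms(3), of n "n * (i - 1)"] by (simp add: algebra_simps)
    then show ?case using step2 assms by simp
  qed (simp add: action_0 assms(3))
  ultimately show ?thesis by simp
qed

section \<open>Mapping tori of coprime powers\<close>

theorem theorem1p1:
  fixes F :: "'a topology" and \<mu> :: "'a \<Rightarrow> 'a chain set" and \<phi> :: "'a \<Rightarrow> 'a" and k :: int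
    and x y :: "('a \<times> real) set"
  assumes "closed_surface F" and "connected_space F" and "surface_orientation F \<mu>"
    and "homeomorphic_map F F \<phi>" and "periodic_map F \<phi>" and "orientation_preserving F \<mu> \<phi>"
    and "coprime k (int (map_order F \<phi>))"
    and "x \<in> topspace (mapping_torus F \<phi>)"
    and "y \<in> topspace (mapping_torus F (map_int_power F \<phi> k))"
  shows "same_finite_quotients
           (fundamental_group (mapping_torus F \<phi>) x)
           (fundamental_group (mapping_torus F (map_int_power F \<phi> k)) y) \<and>
         isomorphic_profinite_completions
           (fundamental_group (mapping_torus F \<phi>) x)
           (fundamental_group (mapping_torus F (map_int_power F \<phi> k)) y)"
proof -
  \<comment> \<open>The group of \<open>\<phi>\<^sup>k\<close> uses the action \<open>\<rho>'\<close> of the integers through multiples of \<open>k\<close>.\<close>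
  define n where "n = map_order F \<phi>"
  define \<rho> where "\<rho> = map_int_power F \<phi>"
  define \<rho>' where "\<rho>' d = \<rho> (k * d)" for d
  let ?G = "fundamental_group (mapping_torus F \<phi>) x"
  let ?H = "fundamental_group (mapping_torus F (map_int_power F \<phi> k)) y"
  have "\<exists>n. n \<ge> 1 \<and> (\<forall>z \<in> topspace F. (\<phi> ^^ n) z = z)" using assms(5) by (simp add: periodic_map_def)
  then have n: "n \<ge> 1" "\<And>z. z \<in> topspace F \<Longrightarrow> (\<phi> ^^ n) z = z"
    unfolding n_def map_order_def by (rule LeastI2_ex; blast)+
  interpret \<rho>: integer_action F \<rho> unfolding \<rho>_def by (rule integer_action_map_int_power[OF assms(4)])
  interpret \<rho>': integer_action F \<rho>'
    by unfold_locales (simp_all add: \<rho>'_def \<rho>.continuous_action \<rho>.action_0 \<rho>.action_add distrib_left)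
  have per: "\<rho> c z = z" if "int n dvd c" "z \<in> topspace F" for c z
    using \<rho>.action_multiples[OF _ that] n(2) by (simp add: \<rho>_def map_int_power_def)
  have \<rho>1: "\<rho> 1 = \<phi>" by (simp add: \<rho>_def map_int_power_def)
  have \<rho>'1: "\<rho>' 1 = map_int_power F \<phi> k" by (simp add: \<rho>'_def \<rho>_def)
  have pc: "path_connected_space F"
    using assms(1,2) surface_locally_path_connected path_connected_eq_connected_space
    by (auto simp: closed_surface_def)
  obtain x0 where x0: "x0 \<in> topspace F"
    using assms(8) unfolding \<rho>1[symmetric] \<rho>.topspace_torus_covering by auto
  obtain \<Theta> where "twisted_path_group F \<rho> ?G x0 \<Theta>"
    using \<rho>.fundamental_group_torus[OF pc x0, of x] assms(8) \<rho>1 by auto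
  then interpret P: twisted_path_group F \<rho> ?G x0 \<Theta> .
  obtain \<Theta>' where "twisted_path_group F \<rho>' ?H x0 \<Theta>'"
    using \<rho>'.fundamental_group_torus[OF pc x0, of y] assms(9) \<rho>'1 by auto
  then interpret Q: twisted_path_group F \<rho>' ?H x0 \<Theta>' .
  interpret P: periodic_twisted_path_group F \<rho> ?G x0 \<Theta> n by unfold_locales (rule per)
  interpret Q: periodic_twisted_path_group F \<rho>' ?H x0 \<Theta>' n by unfold_locales (simp add: \<rho>'_def per)
  obtain a where "int n dvd k * a - 1" using coprime_inverse_mod assms(7) unfolding n_def by blast
  then have a: "int n dvd a * k - 1" by (simp add: mult.commute)
  obtain A B where A: "\<And>i. int n dvd A i - a" and B: "\<And>i. int n dvd B i - k"
    and AB: "\<And>i. int n * fact i dvd A i * B i - 1"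
    and step: "\<And>i. int n * fact i dvd A (Suc i) - A i" "\<And>i. int n * fact i dvd B (Suc i) - B i"
    using profinite_unit_approximation[OF a] n(1) by auto
  \<comment> \<open>The first multiplier satisfies \<open>k * A i \<equiv> 1\<close>, the second \<open>B i \<equiv> k\<close>, both modulo \<open>n\<close>.\<close>
  interpret A: rescaled_twisted_path_groups F \<rho> ?G x0 \<Theta> n \<rho>' ?H \<Theta>' A
  proof
    fix z i d assume z: "z \<in> topspace F"
    have "int n dvd (k * (A i - a) + (a * k - 1)) * d" using A[of i] a by simp
    then have "int n dvd k * (A i * d) - d" by (simp add: algebra_simps)
    then show "\<rho>' (A i * d) z = \<rho> d z" using P.action_cong z by (simp add: \<rho>'_def)
  qed (rule step)
  interpret B: rescaled_twisted_path_groups F \<rho>' ?H x0 \<Theta>' n \<rho> ?G \<Theta> B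
  proof
    fix z i d assume z: "z \<in> topspace F"
    have "int n dvd (B i - k) * d" using B[of i] by simp
    then have "int n dvd B i * d - k * d" by (simp add: algebra_simps)
    then show "\<rho> (B i * d) z = \<rho>' d z" using P.action_cong z by (simp add: \<rho>'_def)
  qed (rule step)
  interpret profinitely_inverse_homs ?G ?H A.rescale_hom B.rescale_hom
    using rescale_hom_composite[OF A.rescaled_twisted_path_groups_axioms B.rescaled_twisted_path_groups_axioms AB]
      rescale_hom_composite[OF B.rescaled_twisted_path_groups_axioms A.rescaled_twisted_path_groups_axioms]
      AB by unfold_locales (simp_all add: mult.commute)
  show ?thesis by (rule profinitely_equivalent)
qed

end
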